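(* Every smooth manifold (finite-dimensional, Hausdorff, second countable and without boundary), equipped with its standard diffeology, is a fibrant diffeological space.
   Context: A diffeological space is a set $X$ together with, for each $n\in\mathbb{N}$ and each open $U\subseteq\mathbb{R}^n$, a specified set of functions $U\to X$ called plots, such that: every constant map is a plot; if $U\to X$ is a plot and $V\to U$ is a smooth map between open subsets of Euclidean spaces then the composite $V\to X$ is a plot; and a function $U\to X$ whose restriction to each member of some open cover of $U$ is a plot is itself a plot. A map $f:X\to Y$ is smooth if $f\circ p$ is a plot of $Y$ for every plot $p$ of $X$; $C^\infty(X,Y)$ is the set of smooth maps. A smooth manifold has the standard diffeology, whose plots are the usual smooth maps from open subsets of Euclidean spaces. A subset $A\subseteq X$ has the sub-diffeology: $U\to A$ is a plot iff $U\to A\hookrightarrow X$ is. Let $\mathbb{A}^n=\{(x_0,\dots,x_n)\in\mathbb{R}^{n+1}\mid\sum x_i=1\}$ with the sub-diffeology from $\mathbb{R}^{n+1}$. A map $f:\{0,\dots,n\}\to\{0,\dots,m\}$ in the simplicial category induces $f_*:\mathbb{A}^n\to\mathbb{A}^m$, $f_*(x)_j=\sum_{i\in f^{-1}(j)}x_i$. $S^D(X)$ is the simplicial set with $S^D_n(X)=C^\infty(\mathbb{A}^n,X)$ and structure maps given by precomposition. A diffeological space $X$ is fibrant if $S^D(X)$ is a Kan complex. *)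

theory Defs
  imports "HOL-Analysis.Analysis"
begin

section \<open>Smooth maps between open subsets of Euclidean spaces\<close>

text \<open>
  The dimension has to range over all natural numbers inside the definitions below, so \<open>\<real>\<^sup>n\<close> is
  the library's \<^term>\<open>Euclidean_space n\<close>: sequences vanishing from index \<open>n\<close> on, with the
  topology induced from the product topology. A function on \<open>U\<close> is of class \<open>C\<^sup>k\<close> if all its
  iterated partial derivatives of order at most \<open>k\<close> exist and are continuous on \<open>U\<close>; this is
  meant for open \<open>U\<close>, where it does not depend on values outside \<open>U\<close>.
\<close>

primrec Ck_on :: "nat \<Rightarrow> nat \<Rightarrow> (nat \<Rightarrow> real) set \<Rightarrow> ((nat \<Rightarrow> real) \<Rightarrow> real) \<Rightarrow> bool" where
  "Ck_on 0 n U f \<longleftrightarrow> continuous_map (subtopology (Euclidean_space n) U) euclideanreal f"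
| "Ck_on (Suc k) n U f \<longleftrightarrow>
     continuous_map (subtopology (Euclidean_space n) U) euclideanreal f \<and>
     (\<forall>i<n. \<exists>g. (\<forall>x\<in>U. ((\<lambda>t. f (x(i := t))) has_real_derivative g x) (at (x i))) \<and> Ck_on k n U g)"

definition smooth_on ::
    "nat \<Rightarrow> (nat \<Rightarrow> real) set \<Rightarrow> nat \<Rightarrow> ((nat \<Rightarrow> real) \<Rightarrow> nat \<Rightarrow> real) \<Rightarrow> bool" where
  "smooth_on n U m f \<longleftrightarrow>
     f ` U \<subseteq> topspace (Euclidean_space m) \<and> (\<forall>j<m. \<forall>k. Ck_on k n U (\<lambda>x. f x j))"

section \<open>Diffeological spaces\<close>

text \<open>
  \<open>plots X n U\<close> is the set of plots with domain the open set \<open>U \<subseteq> \<real>\<^sup>n\<close>. Functions on a set are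
  elements of the extensional function space, so that two plots are equal iff they agree on \<open>U\<close>.
\<close>

record 'a diff_space =
  points :: "'a set"
  plots :: "nat \<Rightarrow> (nat \<Rightarrow> real) set \<Rightarrow> ((nat \<Rightarrow> real) \<Rightarrow> 'a) set"

locale diffeological_space =
  fixes X :: "'a diff_space"
  assumes plot_domain: "p \<in> plots X n U \<Longrightarrow> openin (Euclidean_space n) U"
    and plot_funcset: "p \<in> plots X n U \<Longrightarrow> p \<in> U \<rightarrow>\<^sub>E points X"
    and plot_const: "\<lbrakk>openin (Euclidean_space n) U; c \<in> points X\<rbrakk> \<Longrightarrow> (\<lambda>u\<in>U. c) \<in> plots X n U"
    and plot_compose:
      "\<lbrakk>p \<in> plots X n U; openin (Euclidean_space m) V; f \<in> V \<rightarrow> U; smooth_on m V n f\<rbrakk>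
       \<Longrightarrow> compose V p f \<in> plots X m V"
    and plot_local:
      "\<lbrakk>p \<in> U \<rightarrow>\<^sub>E points X; \<forall>V\<in>\<V>. openin (Euclidean_space n) V; \<Union>\<V> = U;
        \<forall>V\<in>\<V>. restrict p V \<in> plots X n V\<rbrakk>
       \<Longrightarrow> p \<in> plots X n U"

definition smooth_maps :: "'a diff_space \<Rightarrow> 'b diff_space \<Rightarrow> ('a \<Rightarrow> 'b) set" where
  "smooth_maps X Y =
     {f \<in> points X \<rightarrow>\<^sub>E points Y. \<forall>n U. \<forall>p \<in> plots X n U. compose U f p \<in> plots Y n U}"

definition sub_diffeology :: "'a diff_space \<Rightarrow> 'a set \<Rightarrow> 'a diff_space" where
  "sub_diffeology X A =
     \<lparr>points = A, plots = (\<lambda>n U. {p \<in> plots X n U. p \<in> U \<rightarrow> A})\<rparr>"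

definition euclidean_diffeology :: "nat \<Rightarrow> (nat \<Rightarrow> real) diff_space" where
  "euclidean_diffeology N =
     \<lparr>points = topspace (Euclidean_space N),
      plots = (\<lambda>n U. {p \<in> U \<rightarrow>\<^sub>E topspace (Euclidean_space N).
                        openin (Euclidean_space n) U \<and> smooth_on n U N p})\<rparr>"

section \<open>Smooth manifolds and their standard diffeology\<close>

text \<open>
  A smooth structure is given by a smooth atlas, which need not be maximal. A chart \<open>(V, \<phi>)\<close>
  consists of an open subset of \<open>M\<close> and a homeomorphism onto an open subset of \<open>\<real>\<^sup>d\<close>.
\<close>

locale smooth_manifold =
  fixes d :: nat
    and M :: "'a topology"
    and \<A> :: "('a set \<times> ('a \<Rightarrow> nat \<Rightarrow> real)) set"
  assumes Hausdorff: "Hausdorff_space M"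
    and second_countable: "second_countable M"
    and chart_domain: "(V, \<phi>) \<in> \<A> \<Longrightarrow> openin M V"
    and chart_image: "(V, \<phi>) \<in> \<A> \<Longrightarrow> openin (Euclidean_space d) (\<phi> ` V)"
    and chart_homeomorphic:
      "(V, \<phi>) \<in> \<A> \<Longrightarrow>
       homeomorphic_map (subtopology M V) (subtopology (Euclidean_space d) (\<phi> ` V)) \<phi>"
    and charts_cover: "(\<Union>(V, \<phi>)\<in>\<A>. V) = topspace M"
    and transition_smooth:
      "\<lbrakk>(V, \<phi>) \<in> \<A>; (W, \<psi>) \<in> \<A>\<rbrakk>
       \<Longrightarrow> smooth_on d (\<phi> ` (V \<inter> W)) d (\<lambda>x. \<psi> (inv_into V \<phi> x))"

definition manifold_diffeology ::
    "nat \<Rightarrow> 'a topology \<Rightarrow> ('a set \<times> ('a \<Rightarrow> nat \<Rightarrow> real)) set \<Rightarrow> 'a diff_space" where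
  "manifold_diffeology d M \<A> =
     \<lparr>points = topspace M,
      plots = (\<lambda>n U. {p \<in> U \<rightarrow>\<^sub>E topspace M.
                openin (Euclidean_space n) U \<and>
                continuous_map (subtopology (Euclidean_space n) U) M p \<and>
                (\<forall>(V, \<phi>)\<in>\<A>. smooth_on n {u \<in> U. p u \<in> V} d (\<lambda>u. \<phi> (p u)))})\<rparr>"

section \<open>Simplicial sets and Kan complexes\<close>

text \<open>Morphisms \<open>[m] \<rightarrow> [n]\<close> of the simplicial category, where \<open>[n] = {0, \<dots>, n}\<close>.\<close>

definition simplex_hom :: "nat \<Rightarrow> nat \<Rightarrow> (nat \<Rightarrow> nat) set" where
  "simplex_hom m n = {\<alpha> \<in> {..m} \<rightarrow>\<^sub>E {..n}. mono_on {..m} \<alpha>}"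

text \<open>
  \<open>act S m n \<alpha>\<close> is the structure map \<open>S\<^sub>n \<rightarrow> S\<^sub>m\<close> induced by \<open>\<alpha> : [m] \<rightarrow> [n]\<close>; only its
  values on \<open>cells S n\<close> are meaningful.
\<close>

record 's simp_set =
  cells :: "nat \<Rightarrow> 's set"
  act :: "nat \<Rightarrow> nat \<Rightarrow> (nat \<Rightarrow> nat) \<Rightarrow> 's \<Rightarrow> 's"

locale simplicial_set =
  fixes S :: "'s simp_set"
  assumes act_cells: "\<lbrakk>\<alpha> \<in> simplex_hom m n; x \<in> cells S n\<rbrakk> \<Longrightarrow> act S m n \<alpha> x \<in> cells S m"
    and act_id: "x \<in> cells S n \<Longrightarrow> act S n n (\<lambda>i\<in>{..n}. i) x = x"
    and act_compose:
      "\<lbrakk>\<alpha> \<in> simplex_hom l m; \<beta> \<in> simplex_hom m n; x \<in> cells S n\<rbrakk>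
       \<Longrightarrow> act S l n (compose {..l} \<beta> \<alpha>) x = act S l m \<alpha> (act S m n \<beta> x)"

definition simplicial_map :: "'s simp_set \<Rightarrow> 't simp_set \<Rightarrow> (nat \<Rightarrow> 's \<Rightarrow> 't) \<Rightarrow> bool" where
  "simplicial_map S T \<sigma> \<longleftrightarrow>
     (\<forall>n. \<forall>x \<in> cells S n. \<sigma> n x \<in> cells T n) \<and>
     (\<forall>m n. \<forall>\<alpha> \<in> simplex_hom m n. \<forall>x \<in> cells S n.
        \<sigma> m (act S m n \<alpha> x) = act T m n \<alpha> (\<sigma> n x))"

definition std_simplex :: "nat \<Rightarrow> (nat \<Rightarrow> nat) simp_set" where
  "std_simplex n =
     \<lparr>cells = (\<lambda>m. simplex_hom m n), act = (\<lambda>l m \<alpha> \<theta>. compose {..l} \<theta> \<alpha>)\<rparr>"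

text \<open>The horn \<open>\<Lambda>\<^sup>n\<^sub>k\<close> is the union of the faces of \<open>\<Delta>\<^sup>n\<close> opposite to the vertices \<open>i \<noteq> k\<close>.\<close>

definition horn :: "nat \<Rightarrow> nat \<Rightarrow> (nat \<Rightarrow> nat) simp_set" where
  "horn n k =
     \<lparr>cells = (\<lambda>m. {\<theta> \<in> simplex_hom m n. \<exists>i\<le>n. i \<noteq> k \<and> i \<notin> \<theta> ` {..m}}),
      act = act (std_simplex n)\<rparr>"

definition kan_complex :: "'s simp_set \<Rightarrow> bool" where
  "kan_complex S \<longleftrightarrow>
     simplicial_set S \<and>
     (\<forall>n\<ge>1. \<forall>k\<le>n. \<forall>\<sigma>. simplicial_map (horn n k) S \<sigma> \<longrightarrow>
        (\<exists>\<tau>. simplicial_map (std_simplex n) S \<tau> \<and>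
             (\<forall>m. \<forall>\<theta> \<in> cells (horn n k) m. \<tau> m \<theta> = \<sigma> m \<theta>)))"

section \<open>The smooth singular simplicial set and fibrant diffeological spaces\<close>

definition affine_simplex :: "nat \<Rightarrow> (nat \<Rightarrow> real) diff_space" where
  "affine_simplex n =
     sub_diffeology (euclidean_diffeology (Suc n))
       {x \<in> topspace (Euclidean_space (Suc n)). (\<Sum>i\<le>n. x i) = 1}"

text \<open>For \<open>\<alpha> : [m] \<rightarrow> [n]\<close>, the coordinates of the image beyond index \<open>n\<close> are empty sums.\<close>

definition affine_push :: "nat \<Rightarrow> (nat \<Rightarrow> nat) \<Rightarrow> (nat \<Rightarrow> real) \<Rightarrow> nat \<Rightarrow> real" where
  "affine_push m \<alpha> x = (\<lambda>j. \<Sum>i | i \<le> m \<and> \<alpha> i = j. x i)"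

definition smooth_singular :: "'a diff_space \<Rightarrow> ((nat \<Rightarrow> real) \<Rightarrow> 'a) simp_set" where
  "smooth_singular X =
     \<lparr>cells = (\<lambda>n. smooth_maps (affine_simplex n) X),
      act = (\<lambda>m n \<alpha> f. compose (points (affine_simplex m)) f (affine_push m \<alpha>))\<rparr>"

definition fibrant :: "'a diff_space \<Rightarrow> bool" where
  "fibrant X \<longleftrightarrow> diffeological_space X \<and> kan_complex (smooth_singular X)"

end

theory Submission
  imports Defs
begin

text \<open>
  A horn in the smooth singular set of a manifold \<open>M\<close> amounts to a compatible family of smooth
  maps into \<open>M\<close> on faces of an affine simplex, that is, after the choice of affine coordinates, on
  coordinate hyperplanes \<open>x\<^sub>i = 0\<close> of a Euclidean space. Compatibility means that any two
  of the maps agree where their hyperplanes meet. Filling the horn means extending the family to a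
  smooth map on the whole space. Neither embeddings with tubular neighbourhoods nor flows are needed.

  For real-valued maps such an extension exists globally: add the hyperplanes one at a time and
  correct the extension \<open>G\<close> obtained so far to \<open>G + (g\<^sub>i - G) \<circ> z\<^sub>i\<close>, where \<open>z\<^sub>i\<close> sets the \<open>i\<close>-th
  coordinate to zero (\<open>smooth_extension_from_hyperplanes\<close>). Applied to the components in a chart,
  this extends a family of maps into \<open>M\<close> near each point of the union \<open>H\<close> of the hyperplanes.
  If an extension \<open>F\<close> is already given on some open set, then near \<open>H\<close> the two extensions take
  values in the same convex piece of the chart, since they agree on \<open>H\<close>; there they are blended by
  means of a bump function, after some points that do not lie on \<open>H\<close> have been removed from the
  domain of \<open>F\<close> (\<open>extends_over_nbhd\<close>). Finitely many such changes treat a compact part of \<open>H\<close>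
  (\<open>extends_over_compact\<close>). Treating the spherical shells of \<open>H\<close> one after another, with changes
  only outside larger and larger balls, leads to a limit that is smooth on an open
  neighbourhood \<open>U\<close> of all of \<open>H\<close> (\<open>extension_near_hyper\<close>).

  Finally \<open>U\<close> is replaced by the whole space. Let \<open>P\<close> be the product of the coordinates that define
  the hyperplanes. If the nonnegative smooth function \<open>C\<close> grows fast enough, then the map
  \<open>r x = x / (1 + C x * (P x)\<^sup>2)\<close> has values in \<open>U\<close>: a point \<open>x\<close> with \<open>C x * (P x)\<^sup>2\<close> large is
  moved close to the origin, and otherwise \<open>P x\<close> is so small that \<open>r x\<close> is still close to \<open>H\<close>. Since \<open>r\<close> is
  the identity on \<open>H\<close>, the composite \<open>F \<circ> r\<close> is the extension sought (\<open>global_extension\<close>).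

  On the simplicial side, a horn is evaluated on the idempotent monotone maps of \<open>{0, \<dots>, n}\<close> that
  miss exactly one vertex \<open>i\<close>. Their values are \<open>n\<close>-simplices of \<open>M\<close> that restrict to the given maps
  on the faces, and idempotents that miss two vertices show that they are compatible. No
  simplicial identities between face maps are needed (\<open>horn_filler\<close>).
\<close>

section \<open>Open subsets of Euclidean spaces\<close>

text \<open>
  The underlying set of the \<open>n\<close>-dimensional Euclidean space. Its topology is the subspace topology of
  the type class topology on functions, so that results on \<^term>\<open>continuous_on\<close> apply.
\<close>

abbreviation eucl :: "nat \<Rightarrow> (nat \<Rightarrow> real) set" where
  "eucl n \<equiv> {x. \<forall>i\<ge>n. x i = 0}"

abbreviation open_eucl :: "nat \<Rightarrow> (nat \<Rightarrow> real) set \<Rightarrow> bool" where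
  "open_eucl n \<equiv> openin (Euclidean_space n)"

text \<open>
  The balls of the maximum norm; they form a neighbourhood basis (\<open>open_eucl_cubeE\<close>).
\<close>

definition cube :: "nat \<Rightarrow> (nat \<Rightarrow> real) \<Rightarrow> real \<Rightarrow> (nat \<Rightarrow> real) set" where
  "cube n x e = {y \<in> eucl n. \<forall>j<n. \<bar>y j - x j\<bar> < e}"

lemma Euclidean_space_eq: "Euclidean_space n = top_of_set (eucl n)"
  by (simp add: Euclidean_space_def euclidean_product_topology)

lemma continuous_map_eucl_iff:
  assumes "U \<subseteq> eucl n"
  shows "continuous_map (subtopology (Euclidean_space n) U) euclideanreal f \<longleftrightarrow> continuous_on U f"
  using assms
  by (simp add: Euclidean_space_eq subtopology_subtopology Int_absorb1)

lemma open_eucl_cube: "open_eucl n (cube n x e)"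
proof -
  have "open (\<Inter>j<n. {y::nat\<Rightarrow>real. \<bar>y j - x j\<bar> < e})"
    by (intro open_INT finite_lessThan ballI open_Collect_less continuous_intros
        continuous_on_product_coordinates)
  moreover have "cube n x e = eucl n \<inter> (\<Inter>j<n. {y::nat\<Rightarrow>real. \<bar>y j - x j\<bar> < e})"
    by (auto simp: cube_def)
  ultimately show ?thesis
    unfolding Euclidean_space_eq openin_open by blast
qed

lemma open_eucl_subset: "open_eucl n U \<Longrightarrow> U \<subseteq> eucl n"
  using openin_subset topspace_Euclidean_space by fastforce

lemma open_eucl_cubeE:
  assumes "open_eucl n U" "x \<in> U"
  obtains e where "e > 0" "cube n x e \<subseteq> U"
proof -
  obtain T where T: "open T" "U = eucl n \<inter> T"
    using assms(1) unfolding Euclidean_space_eq openin_open by blast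
  have "openin (product_topology (\<lambda>i. euclidean) UNIV) T"
    using T(1) by (simp add: euclidean_product_topology)
  then obtain X where X: "x \<in> (\<Pi>\<^sub>E i\<in>UNIV. X i)" "\<And>i. open (X i :: real set)"
      "(\<Pi>\<^sub>E i\<in>UNIV. X i) \<subseteq> T"
    using product_topology_open_contains_basis[of "\<lambda>i. euclidean" UNIV T x] T(2) assms(2) by auto
  have "\<exists>d>0. \<forall>t. \<bar>t - x i\<bar> < d \<longrightarrow> t \<in> X i" for i
  proof -
    have "x i \<in> X i" using X(1) by auto
    then show ?thesis using X(2)[of i] unfolding open_dist dist_real_def by blast
  qed
  then obtain d where d: "\<And>i. d i > 0" "\<And>i t. \<bar>t - x i\<bar> < d i \<Longrightarrow> t \<in> X i"
    by metis
  define e where "e = Min (insert 1 (d ` {..<n}))"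
  have e: "e > 0" unfolding e_def using d(1) by (subst Min_gr_iff) auto
  have e': "e \<le> d i" if "i < n" for i
    unfolding e_def using that by (intro Min_le) auto
  have "cube n x e \<subseteq> U"
  proof
    fix y assume y: "y \<in> cube n x e"
    have "y i \<in> X i" for i
    proof (cases "i < n")
      case True
      then show ?thesis using y e' d(2)[of "y i" i] unfolding cube_def by fastforce
    next
      case False
      have "x i = 0" "y i = 0"
        using False y assms(2) T(2) unfolding cube_def by auto
      then show ?thesis using d(2)[of "y i" i] d(1)[of i] by simp
    qed
    then have "y \<in> T" using X(3) by auto
    then show "y \<in> U" using y T(2) unfolding cube_def by auto
  qed
  with e that show thesis by blast
qed

lemma open_euclI:
  assumes "U \<subseteq> eucl n" "\<And>x. x \<in> U \<Longrightarrow> \<exists>V. open_eucl n V \<and> x \<in> V \<and> V \<subseteq> U"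
  shows "open_eucl n U"
  using assms by (subst openin_subopen) blast

lemma centre_in_cube: "x \<in> eucl n \<Longrightarrow> e > 0 \<Longrightarrow> x \<in> cube n x e"
  by (auto simp: cube_def)

lemma continuous_on_cubeE:
  assumes "open_eucl n U" "continuous_on U f" "x \<in> U" "e > 0"
  obtains d where "d > 0" "cube n x d \<subseteq> U" "\<And>y. y \<in> cube n x d \<Longrightarrow> \<bar>f y - f x :: real\<bar> < e"
proof -
  have "openin (top_of_set U) (U \<inter> f -` {t. \<bar>t - f x\<bar> < e})"
    by (intro continuous_openin_preimage_gen assms(2) open_Collect_less continuous_intros)
  then have "open_eucl n (U \<inter> f -` {t. \<bar>t - f x\<bar> < e})"
    using assms(1) unfolding Euclidean_space_eq by (meson openin_trans)
  then obtain d where "d > 0" "cube n x d \<subseteq> U \<inter> f -` {t. \<bar>t - f x\<bar> < e}"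
    by (rule open_eucl_cubeE) (use assms in auto)
  with that show thesis by fastforce
qed

lemma eventually_upd_in:
  assumes "open_eucl n U" "x \<in> U" "i < n"
  shows "eventually (\<lambda>t. x(i := t) \<in> U) (nhds (x i))"
proof -
  obtain e where e: "e > 0" "cube n x e \<subseteq> U" using assms open_eucl_cubeE by metis
  have "eventually (\<lambda>t. \<bar>t - x i\<bar> < e) (nhds (x i))"
    using e(1) unfolding eventually_nhds_metric dist_real_def by auto
  then show ?thesis
  proof eventually_elim
    case (elim t)
    have "x \<in> eucl n" using assms open_eucl_subset by blast
    then have "x(i := t) \<in> cube n x e" using elim e(1) assms(3) by (auto simp: cube_def)
    then show ?case using e by blast
  qed
qed

section \<open>Functions of class \<open>C\<^sup>k\<close>\<close>

text \<open>
  The recursion for \<^term>\<open>Ck_on\<close> asks for some function that is the partial derivative on \<open>U\<close>.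
  Fixing one choice makes it possible to pass from local to global statements.
\<close>

definition partial_deriv :: "nat \<Rightarrow> ((nat \<Rightarrow> real) \<Rightarrow> real) \<Rightarrow> (nat \<Rightarrow> real) \<Rightarrow> real" where
  "partial_deriv i f x = deriv (\<lambda>t. f (x(i := t))) (x i)"

lemma Ck_on_continuous: "Ck_on k n U f \<Longrightarrow> U \<subseteq> eucl n \<Longrightarrow> continuous_on U f"
  by (cases k) (auto simp: continuous_map_eucl_iff)

lemma Ck_on_cong:
  assumes U: "open_eucl n U" and eq: "\<And>x. x \<in> U \<Longrightarrow> f x = g x" and f: "Ck_on k n U f"
  shows "Ck_on k n U g"
proof -
  have sub: "U \<subseteq> eucl n" using U by (rule open_eucl_subset)
  have cont: "continuous_on U g"
    using continuous_on_cong[of U U f g] Ck_on_continuous[OF f sub] eq by simp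
  show ?thesis
  proof (cases k)
    case 0
    then show ?thesis using cont sub by (simp add: continuous_map_eucl_iff)
  next
    case (Suc k')
    have *: "((\<lambda>t. g (x(i := t))) has_real_derivative h x) (at (x i))"
      if "i < n" "x \<in> U" "((\<lambda>t. f (x(i := t))) has_real_derivative h x) (at (x i))" for i h x
    proof -
      have "eventually (\<lambda>t. f (x(i := t)) = g (x(i := t))) (nhds (x i))"
        using eventually_upd_in[OF U that(2,1)] by eventually_elim (rule eq)
      from iffD1[OF DERIV_cong_ev[OF refl this refl] that(3)] show ?thesis .
    qed
    show ?thesis
      unfolding Suc Ck_on.simps continuous_map_eucl_iff[OF sub]
    proof (intro conjI cont allI impI)
      fix i assume i: "i < n"
      then obtain h where "\<forall>x\<in>U. ((\<lambda>t. f (x(i := t))) has_real_derivative h x) (at (x i))"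
          "Ck_on k' n U h"
        using f unfolding Suc Ck_on.simps by blast
      then show "\<exists>h. (\<forall>x\<in>U. ((\<lambda>t. g (x(i := t))) has_real_derivative h x) (at (x i))) \<and> Ck_on k' n U h"
        using *[OF i] by blast
    qed
  qed
qed

lemma Ck_on_Suc_partial_deriv:
  assumes U: "open_eucl n U"
  shows "Ck_on (Suc k) n U f \<longleftrightarrow> continuous_on U f \<and>
    (\<forall>i<n. (\<forall>x\<in>U. ((\<lambda>t. f (x(i := t))) has_real_derivative partial_deriv i f x) (at (x i))) \<and> Ck_on k n U (partial_deriv i f))"
    (is "?L \<longleftrightarrow> ?R")
proof
  assume ?R
  then show ?L unfolding Ck_on.simps continuous_map_eucl_iff[OF open_eucl_subset[OF U]] by blast
next
  assume L: ?L
  have "(\<forall>x\<in>U. ((\<lambda>t. f (x(i := t))) has_real_derivative partial_deriv i f x) (at (x i))) \<and> Ck_on k n U (partial_deriv i f)"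
    if i: "i < n" for i
  proof -
    obtain g where g: "\<forall>x\<in>U. ((\<lambda>t. f (x(i := t))) has_real_derivative g x) (at (x i))" "Ck_on k n U g"
      using L i by auto
    then have "\<forall>x\<in>U. g x = partial_deriv i f x" unfolding partial_deriv_def by (metis DERIV_imp_deriv)
    then show ?thesis using g Ck_on_cong[OF U _ g(2), of "partial_deriv i f"] by metis
  qed
  then show ?R using L open_eucl_subset[OF U] by (auto simp: continuous_map_eucl_iff)
qed

lemma Ck_on_SucI:
  assumes "U \<subseteq> eucl n" "continuous_on U f"
    "\<And>i x. i < n \<Longrightarrow> x \<in> U \<Longrightarrow> ((\<lambda>t. f (x(i := t))) has_real_derivative g i x) (at (x i))"
    "\<And>i. i < n \<Longrightarrow> Ck_on k n U (g i)"
  shows "Ck_on (Suc k) n U f"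
  using assms(2-) unfolding Ck_on.simps continuous_map_eucl_iff[OF assms(1)] by blast

lemma Ck_on_SucD: "Ck_on (Suc k) n U f \<Longrightarrow> Ck_on k n U f"
proof (induction k arbitrary: f)
  case (Suc k)
  then show ?case by (simp only: Ck_on.simps(2)) blast
qed auto

lemma Ck_on_subset: "Ck_on k n U f \<Longrightarrow> U' \<subseteq> U \<Longrightarrow> Ck_on k n U' f"
proof (induction k arbitrary: f)
  case 0
  then show ?case by (auto intro: continuous_map_from_subtopology_mono)
next
  case (Suc k)
  then show ?case unfolding Ck_on.simps
    by (meson continuous_map_from_subtopology_mono subsetD)
qed

lemma Ck_on_local:
  assumes "open_eucl n U" "\<And>x. x \<in> U \<Longrightarrow> \<exists>V. open_eucl n V \<and> x \<in> V \<and> V \<subseteq> U \<and> Ck_on k n V f"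
  shows "Ck_on k n U f"
  using assms(2)
proof (induction k arbitrary: f)
  case 0
  note sub = open_eucl_subset[OF assms(1)]
  show ?case using 0 sub
  proof -
    have "continuous (at x within U) f" if x: "x \<in> U" for x
    proof -
      obtain V where V: "open_eucl n V" "x \<in> V" "V \<subseteq> U" "Ck_on 0 n V f" using 0 x by blast
      then have "continuous_on V f" using Ck_on_continuous open_eucl_subset by blast
      moreover obtain T where T: "open T" "V = eucl n \<inter> T"
        using V(1) unfolding Euclidean_space_eq openin_open by blast
      have "at x within V = at x within U"
        by (rule at_within_nhd[where S = T]) (use V T sub in auto)
      ultimately show ?thesis using V(2) unfolding continuous_on_eq_continuous_within
        by (metis continuous_within)
    qed
    then show ?thesis using sub
      by (simp add: continuous_map_eucl_iff continuous_on_eq_continuous_within)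
  qed
next
  case (Suc k)
  note sub = open_eucl_subset[OF assms(1)]
  have "Ck_on k n U f"
    using Suc.prems by (intro Suc.IH) (meson Ck_on_SucD)
  then have cont: "continuous_on U f" using Ck_on_continuous sub by blast
  have loc: "\<exists>V. open_eucl n V \<and> x \<in> V \<and> V \<subseteq> U \<and> Ck_on k n V (partial_deriv i f) \<and>
      ((\<lambda>t. f (x(i := t))) has_real_derivative partial_deriv i f x) (at (x i))"
    if i: "i < n" and x: "x \<in> U" for i x
  proof -
    obtain V where V: "open_eucl n V" "x \<in> V" "V \<subseteq> U" "Ck_on (Suc k) n V f"
      using Suc.prems x by blast
    show ?thesis
      using V(4)[unfolded Ck_on_Suc_partial_deriv[OF V(1)]] V(1-3) i by blast
  qed
  have "(\<forall>x\<in>U. ((\<lambda>t. f (x(i := t))) has_real_derivative partial_deriv i f x) (at (x i))) \<and> Ck_on k n U (partial_deriv i f)"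
    if i: "i < n" for i
  proof
    show "\<forall>x\<in>U. ((\<lambda>t. f (x(i := t))) has_real_derivative partial_deriv i f x) (at (x i))"
      using loc[OF i] by blast
    show "Ck_on k n U (partial_deriv i f)"
      using loc[OF i] by (intro Suc.IH) meson
  qed
  with cont show ?case using Ck_on_Suc_partial_deriv[OF assms(1)] by blast
qed

lemma Ck_on_const: "Ck_on k n U (\<lambda>x. c)"
proof (induction k arbitrary: c)
  case (Suc k)
  then show ?case by (auto intro!: exI[of _ "\<lambda>x. 0"])
qed auto

lemma Ck_on_coord:
  assumes "U \<subseteq> eucl n"
  shows "Ck_on k n U (\<lambda>x. x j)"
proof (cases k)
  case 0
  then show ?thesis using assms by (simp add: continuous_map_eucl_iff continuous_on_subset[OF continuous_on_product_coordinates])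
next
  case (Suc k')
  show ?thesis unfolding Suc
  proof (rule Ck_on_SucI[OF assms, where g = "\<lambda>i x. if i = j then 1 else 0"])
    show "continuous_on U (\<lambda>x. x j)" by (rule continuous_on_subset[OF continuous_on_product_coordinates]) auto
    show "((\<lambda>t. (x(i := t)) j) has_real_derivative (if i = j then 1 else 0)) (at (x i))" for i x
      by auto
  qed (rule Ck_on_const)
qed

lemma Ck_on_add:
  assumes U: "open_eucl n U"
  shows "Ck_on k n U f \<Longrightarrow> Ck_on k n U g \<Longrightarrow> Ck_on k n U (\<lambda>x. f x + g x)"
proof (induction k arbitrary: f g)
  case 0
  then show ?case by (simp add: continuous_map_add)
next
  case (Suc k)
  note f = Suc.prems(1)[unfolded Ck_on_Suc_partial_deriv[OF U]] and g = Suc.prems(2)[unfolded Ck_on_Suc_partial_deriv[OF U]]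
  show ?case
  proof (rule Ck_on_SucI[OF open_eucl_subset[OF U], where g = "\<lambda>i x. partial_deriv i f x + partial_deriv i g x"])
    show "continuous_on U (\<lambda>x. f x + g x)" using f g by (intro continuous_intros) auto
    show "((\<lambda>t. f (x(i := t)) + g (x(i := t))) has_real_derivative partial_deriv i f x + partial_deriv i g x) (at (x i))"
      if "i < n" "x \<in> U" for i x using f g that by (intro DERIV_add) auto
    show "Ck_on k n U (\<lambda>x. partial_deriv i f x + partial_deriv i g x)" if "i < n" for i
      using f g that by (intro Suc.IH) auto
  qed
qed

lemma Ck_on_mult:
  assumes U: "open_eucl n U"
  shows "Ck_on k n U f \<Longrightarrow> Ck_on k n U g \<Longrightarrow> Ck_on k n U (\<lambda>x. f x * g x)"
proof (induction k arbitrary: f g)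
  case 0
  then show ?case by (simp add: continuous_map_real_mult)
next
  case (Suc k)
  note f = Suc.prems(1)[unfolded Ck_on_Suc_partial_deriv[OF U]] and g = Suc.prems(2)[unfolded Ck_on_Suc_partial_deriv[OF U]]
  show ?case
  proof (rule Ck_on_SucI[OF open_eucl_subset[OF U], where g = "\<lambda>i x. partial_deriv i f x * g x + partial_deriv i g x * f x"])
    show "continuous_on U (\<lambda>x. f x * g x)" using f g by (intro continuous_intros) auto
    show "((\<lambda>t. f (x(i := t)) * g (x(i := t))) has_real_derivative partial_deriv i f x * g x + partial_deriv i g x * f x) (at (x i))"
      if "i < n" "x \<in> U" for i x
    proof -
      have "((\<lambda>t. f (x(i := t)) * g (x(i := t))) has_real_derivative
         partial_deriv i f x * g (x(i := x i)) + partial_deriv i g x * f (x(i := x i))) (at (x i))"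
        using f g that by (intro DERIV_mult) auto
      then show ?thesis by simp
    qed
    show "Ck_on k n U (\<lambda>x. partial_deriv i f x * g x + partial_deriv i g x * f x)" if "i < n" for i
      using f g that Suc.prems[THEN Ck_on_SucD] by (intro Ck_on_add[OF U] Suc.IH) auto
  qed
qed

lemma Ck_on_sum:
  assumes U: "open_eucl n U" and "finite A" "\<And>a. a \<in> A \<Longrightarrow> Ck_on k n U (f a)"
  shows "Ck_on k n U (\<lambda>x. \<Sum>a\<in>A. f a x)"
  using assms(2,3) by (induction A rule: finite_induct) (auto intro: Ck_on_const Ck_on_add[OF U])

lemma Ck_on_inverse:
  assumes U: "open_eucl n U" and nz: "\<And>x. x \<in> U \<Longrightarrow> f x \<noteq> 0"
  shows "Ck_on k n U f \<Longrightarrow> Ck_on k n U (\<lambda>x. inverse (f x))"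
proof (induction k)
  case 0
  then show ?case using nz open_eucl_subset[OF U] by (simp add: continuous_map_eucl_iff continuous_on_inverse)
next
  case (Suc k)
  note f = Suc.prems(1)[unfolded Ck_on_Suc_partial_deriv[OF U]]
  show ?case
  proof (rule Ck_on_SucI[OF open_eucl_subset[OF U],
        where g = "\<lambda>i x. (- 1) * (partial_deriv i f x * (inverse (f x) * inverse (f x)))"])
    show "continuous_on U (\<lambda>x. inverse (f x))" using f nz by (intro continuous_intros) auto
    show "((\<lambda>t. inverse (f (x(i := t)))) has_real_derivative
        (- 1) * (partial_deriv i f x * (inverse (f x) * inverse (f x)))) (at (x i))"
      if "i < n" "x \<in> U" for i x
    proof -
      have "((\<lambda>t. inverse (f (x(i := t)))) has_real_derivative
         - (partial_deriv i f x * inverse ((f (x(i := x i)))^ Suc (Suc 0)))) (at (x i))"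
        using f nz that by (intro DERIV_inverse_fun) auto
      then show ?thesis by simp
    qed
    show "Ck_on k n U (\<lambda>x. (- 1) * (partial_deriv i f x * (inverse (f x) * inverse (f x))))" if "i < n" for i
      using f that Suc.prems[THEN Ck_on_SucD] Suc.IH
      by (intro Ck_on_mult[OF U] Ck_on_const) auto
  qed
qed

text \<open>
  A several-variable form of Caratheodory's description of the derivative. The point \<open>x\<close> is changed
  into \<open>y\<close> one coordinate at a time; \<open>h j y\<close> is the difference quotient of the \<open>j\<close>-th change, and
  the mean value theorem compares it with the partial derivative at a nearby point.
\<close>

lemma C1_slope_decomposition:
  assumes V: "open_eucl m V" and x: "x \<in> V"
    and der: "\<And>j y. j < m \<Longrightarrow> y \<in> V \<Longrightarrow>
      ((\<lambda>t. g (y(j := t))) has_real_derivative g' j y) (at (y j))"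
    and cont: "\<And>j. j < m \<Longrightarrow> continuous_on V (g' j)"
  obtains h where "\<And>y. y \<in> eucl m \<Longrightarrow> g y - g x = (\<Sum>j<m. h j y * (y j - x j))"
    "\<And>j e. j < m \<Longrightarrow> e > 0 \<Longrightarrow> \<exists>d>0. \<forall>y\<in>cube m x d. \<bar>h j y - g' j x\<bar> < e"
proof -
  have xE: "x \<in> eucl m" using V x open_eucl_subset by blast
  define mix where "mix l y = (\<lambda>i. if i < l then y i else x i)" for l :: nat and y :: "nat \<Rightarrow> real"
  define h where "h j y = (if y j = x j then g' j x
      else (g (mix (Suc j) y) - g (mix j y)) / (y j - x j))" for j y
  have mix_Suc: "mix (Suc j) y = (mix j y)(j := y j)" for j y
    by (auto simp: mix_def fun_eq_iff)
  have mix_upd: "(mix j y)(j := x j) = mix j y" for j y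
    by (auto simp: mix_def fun_eq_iff)
  show thesis
  proof
    fix y assume y: "y \<in> eucl m"
    have "mix 0 y = x" "mix m y = y" using xE y by (auto simp: mix_def fun_eq_iff)
    then have "g y - g x = (\<Sum>j<m. g (mix (Suc j) y) - g (mix j y))"
      by (simp add: sum_lessThan_telescope[of "\<lambda>j. g (mix j y)"])
    also have "\<dots> = (\<Sum>j<m. h j y * (y j - x j))"
    proof (rule sum.cong[OF refl])
      fix j
      show "g (mix (Suc j) y) - g (mix j y) = h j y * (y j - x j)"
        using mix_upd[of j y] by (cases "y j = x j") (auto simp: h_def mix_Suc)
    qed
    finally show "g y - g x = (\<Sum>j<m. h j y * (y j - x j))" .
  next
    fix j and e :: real assume j: "j < m" and e: "e > 0"
    obtain d where d: "d > 0" "cube m x d \<subseteq> V" "\<And>y. y \<in> cube m x d \<Longrightarrow> \<bar>g' j y - g' j x\<bar> < e"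
      by (rule continuous_on_cubeE[OF V cont[OF j] x e]) metis
    have "\<bar>h j y - g' j x\<bar> < e" if y: "y \<in> cube m x d" for y
    proof (cases "y j = x j")
      case False
      define \<phi> where "\<phi> t = g ((mix j y)(j := t))" for t
      have inbox: "(mix j y)(j := t) \<in> cube m x d" if "\<bar>t - x j\<bar> < d" for t
        using that y xE j d(1) by (auto simp: cube_def mix_def)
      have yj: "\<bar>y j - x j\<bar> < d" using y j by (auto simp: cube_def)
      have D: "(\<phi> has_real_derivative g' j ((mix j y)(j := t))) (at t)" if "\<bar>t - x j\<bar> < d" for t
      proof -
        have "(mix j y)(j := t) \<in> V" using inbox[OF that] d(2) by blast
        from der[OF j this] show ?thesis unfolding \<phi>_def by simp
      qed
      have "\<exists>t. \<bar>t - x j\<bar> < d \<and> \<phi> (y j) - \<phi> (x j) = (y j - x j) * g' j ((mix j y)(j := t))"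
      proof (cases "x j < y j")
        case True
        have "\<exists>z>x j. z < y j \<and> \<phi> (y j) - \<phi> (x j) = (y j - x j) * g' j ((mix j y)(j := z))"
          using True yj by (intro MVT2 D) auto
        then show ?thesis using yj by (metis abs_of_pos diff_gt_0_iff_gt diff_less_eq diff_add_cancel order.strict_trans)
      next
        case F: False
        then have lt: "y j < x j" using False by simp
        have "\<exists>z>y j. z < x j \<and> \<phi> (x j) - \<phi> (y j) = (x j - y j) * g' j ((mix j y)(j := z))"
          using lt yj by (intro MVT2 D) auto
        then obtain z where z: "y j < z" "z < x j"
            "\<phi> (x j) - \<phi> (y j) = (x j - y j) * g' j ((mix j y)(j := z))" by blast
        have "\<phi> (y j) - \<phi> (x j) = (y j - x j) * g' j ((mix j y)(j := z))"
          using z(3) by (simp add: algebra_simps)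
        then show ?thesis using z yj by (intro exI[of _ z]) auto
      qed
      then obtain t where t: "\<bar>t - x j\<bar> < d"
          "\<phi> (y j) - \<phi> (x j) = (y j - x j) * g' j ((mix j y)(j := t))" by blast
      have "\<phi> (y j) = g (mix (Suc j) y)" "\<phi> (x j) = g (mix j y)"
        by (auto simp: \<phi>_def mix_Suc mix_upd)
      then have "h j y = g' j ((mix j y)(j := t))"
        using t(2) False by (simp add: h_def)
      then show ?thesis using d(3) inbox[OF t(1)] by simp
    qed (use e in \<open>auto simp: h_def\<close>)
    with d(1) show "\<exists>d>0. \<forall>y\<in>cube m x d. \<bar>h j y - g' j x\<bar> < e" by blast
  qed
qed

lemma C1_chain_rule:
  assumes V: "open_eucl m V" and x: "\<gamma> t \<in> V"
    and der: "\<And>j y. j < m \<Longrightarrow> y \<in> V \<Longrightarrow>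
      ((\<lambda>t. g (y(j := t))) has_real_derivative g' j y) (at (y j))"
    and cont: "\<And>j. j < m \<Longrightarrow> continuous_on V (g' j)"
    and \<gamma>: "eventually (\<lambda>s. \<gamma> s \<in> eucl m) (at t)"
      "\<And>j. j < m \<Longrightarrow> ((\<lambda>s. \<gamma> s j) has_real_derivative \<gamma>' j) (at t)"
  shows "((\<lambda>s. g (\<gamma> s)) has_real_derivative (\<Sum>j<m. g' j (\<gamma> t) * \<gamma>' j)) (at t)"
proof -
  obtain h where h: "\<And>y. y \<in> eucl m \<Longrightarrow> g y - g (\<gamma> t) = (\<Sum>j<m. h j y * (y j - \<gamma> t j))"
    "\<And>j e. j < m \<Longrightarrow> e > 0 \<Longrightarrow> \<exists>d>0. \<forall>y\<in>cube m (\<gamma> t) d. \<bar>h j y - g' j (\<gamma> t)\<bar> < e"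
    using C1_slope_decomposition[where g = g and g' = g', OF V x der cont] by blast
  have inbox: "eventually (\<lambda>s. \<gamma> s \<in> cube m (\<gamma> t) d) (at t)" if d: "d > 0" for d
  proof -
    have "\<forall>j\<in>{..<m}. eventually (\<lambda>s. \<bar>\<gamma> s j - \<gamma> t j\<bar> < d) (at t)"
    proof
      fix j assume "j \<in> {..<m}"
      then have "((\<lambda>s. \<gamma> s j) \<longlongrightarrow> \<gamma> t j) (at t)"
        using \<gamma>(2)[of j] DERIV_isCont isContD by fastforce
      then show "eventually (\<lambda>s. \<bar>\<gamma> s j - \<gamma> t j\<bar> < d) (at t)"
        using d by (auto simp: tendsto_iff dist_real_def)
    qed
    then have "eventually (\<lambda>s. \<forall>j\<in>{..<m}. \<bar>\<gamma> s j - \<gamma> t j\<bar> < d) (at t)"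
      by (rule eventually_ball_finite[OF finite_lessThan])
    with \<gamma>(1) show ?thesis by eventually_elim (auto simp: cube_def)
  qed
  have "((\<lambda>s. \<Sum>j<m. h j (\<gamma> s) * ((\<gamma> s j - \<gamma> t j) / (s - t))) \<longlongrightarrow> (\<Sum>j<m. g' j (\<gamma> t) * \<gamma>' j)) (at t)"
  proof (intro tendsto_sum tendsto_mult)
    fix j assume "j \<in> {..<m}"
    then have j: "j < m" by simp
    show "((\<lambda>s. h j (\<gamma> s)) \<longlongrightarrow> g' j (\<gamma> t)) (at t)"
      unfolding tendsto_iff dist_real_def
    proof (intro allI impI)
      fix e :: real assume "e > 0"
      then obtain d where d: "d > 0" "\<forall>y\<in>cube m (\<gamma> t) d. \<bar>h j y - g' j (\<gamma> t)\<bar> < e"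
        using h(2)[OF j] by blast
      show "eventually (\<lambda>s. \<bar>h j (\<gamma> s) - g' j (\<gamma> t)\<bar> < e) (at t)"
        using inbox[OF d(1)] by eventually_elim (use d in blast)
    qed
    show "((\<lambda>s. (\<gamma> s j - \<gamma> t j) / (s - t)) \<longlongrightarrow> \<gamma>' j) (at t)"
      using \<gamma>(2)[OF j] by (simp add: has_field_derivative_iff)
  qed
  moreover have "eventually (\<lambda>s. (\<Sum>j<m. h j (\<gamma> s) * ((\<gamma> s j - \<gamma> t j) / (s - t)))
      = (g (\<gamma> s) - g (\<gamma> t)) / (s - t)) (at t)"
    using \<gamma>(1) by eventually_elim (simp add: h(1) sum_divide_distrib)
  ultimately show ?thesis
    unfolding has_field_derivative_iff by (rule Lim_transform_eventually)
qed

lemma continuous_on_into_eucl: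
  assumes "\<And>j. j < m \<Longrightarrow> continuous_on U (\<lambda>x. f x j)" "f ` U \<subseteq> eucl m"
  shows "continuous_on U (f :: (nat \<Rightarrow> real) \<Rightarrow> nat \<Rightarrow> real)"
proof (rule continuous_on_coordinatewise_then_product)
  fix j
  show "continuous_on U (\<lambda>x. f x j)"
  proof (cases "j < m")
    case False
    then have "\<And>x. x \<in> U \<Longrightarrow> f x j = 0" using assms(2) by auto
    then show ?thesis using continuous_on_cong[of U U "\<lambda>x. f x j" "\<lambda>x. 0"] by simp
  qed (rule assms(1))
qed

lemma Ck_on_compose:
  assumes U: "open_eucl n U" and V: "open_eucl m V" and maps: "f ` U \<subseteq> V"
  shows "Ck_on k m V g \<Longrightarrow> (\<And>j. j < m \<Longrightarrow> Ck_on k n U (\<lambda>x. f x j)) \<Longrightarrow> Ck_on k n U (\<lambda>x. g (f x))"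
proof (induction k arbitrary: g)
  case (0 g)
  have "continuous_on V g" "\<And>j. j < m \<Longrightarrow> continuous_on U (\<lambda>x. f x j)"
    using 0 Ck_on_continuous open_eucl_subset U V by blast+
  moreover then have "continuous_on U f"
    using maps open_eucl_subset[OF V] by (intro continuous_on_into_eucl[where m = m]) blast+
  ultimately have "continuous_on U (\<lambda>x. g (f x))"
    using maps continuous_on_compose2[of V g U f] by blast
  then show ?case using open_eucl_subset[OF U] by (simp add: continuous_map_eucl_iff)
next
  case (Suc k)
  note f = Suc.prems(2)[unfolded Ck_on_Suc_partial_deriv[OF U]] and g = Suc.prems(1)[unfolded Ck_on_Suc_partial_deriv[OF V]]
  have contg': "continuous_on V (partial_deriv j g)" if "j < m" for j
    using g that Ck_on_continuous open_eucl_subset V by blast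
  show ?case
  proof (rule Ck_on_SucI[OF open_eucl_subset[OF U],
        where g = "\<lambda>i x. \<Sum>j<m. partial_deriv j g (f x) * partial_deriv i (\<lambda>x. f x j) x"])
    have "continuous_on U f"
      using f maps open_eucl_subset[OF V] by (intro continuous_on_into_eucl[where m = m]) auto
    then show "continuous_on U (\<lambda>x. g (f x))"
      using g maps continuous_on_compose2[of V g U f] by blast
    show "((\<lambda>t. g (f (x(i := t)))) has_real_derivative (\<Sum>j<m. partial_deriv j g (f x) * partial_deriv i (\<lambda>x. f x j) x)) (at (x i))"
      if i: "i < n" and x: "x \<in> U" for i x
    proof -
      have ev: "eventually (\<lambda>s. f (x(i := s)) \<in> eucl m) (at (x i))"
        unfolding eventually_at_filter using eventually_upd_in[OF U x i]
        by (rule eventually_mono) (use maps open_eucl_subset[OF V] in blast)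
      have "((\<lambda>t. g (f (x(i := t)))) has_real_derivative
          (\<Sum>j<m. partial_deriv j g (f (x(i := x i))) * partial_deriv i (\<lambda>x. f x j) x)) (at (x i))"
      proof (rule C1_chain_rule[where \<gamma> = "\<lambda>t. f (x(i := t))" and g = g, OF V _ _ contg' ev])
        show "f (x(i := x i)) \<in> V" using maps x by auto
        show "((\<lambda>t. g (y(j := t))) has_real_derivative partial_deriv j g y) (at (y j))"
          if "j < m" "y \<in> V" for j y using g that by blast
        show "((\<lambda>s. f (x(i := s)) j) has_real_derivative partial_deriv i (\<lambda>x. f x j) x) (at (x i))"
          if "j < m" for j using f i x that by blast
      qed
      then show ?thesis by simp
    qed
    show "Ck_on k n U (\<lambda>x. \<Sum>j<m. partial_deriv j g (f x) * partial_deriv i (\<lambda>x. f x j) x)" if i: "i < n" for i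
    proof (intro Ck_on_sum[OF U] Ck_on_mult[OF U] finite_lessThan)
      fix j assume "j \<in> {..<m}"
      then have j: "j < m" by simp
      show "Ck_on k n U (\<lambda>x. partial_deriv j g (f x))"
        by (rule Suc.IH) (use g j Ck_on_SucD[OF Suc.prems(2)] in blast)+
      show "Ck_on k n U (partial_deriv i (\<lambda>x. f x j))" using f j i by blast
    qed
  qed
qed

section \<open>Flat functions\<close>

text \<open>
  The functions \<open>exp (- 1 / t) / t\<^sup>k\<close>, extended by zero to \<open>t \<le> 0\<close>. The derivative of such a function
  is a linear combination of two others of the family, so all of them are smooth.
\<close>

definition flat :: "nat \<Rightarrow> real \<Rightarrow> real" where
  "flat k t = (if t > 0 then inverse t ^ k * exp (- inverse t) else 0)"

lemma flat_tendsto_0: "(flat k \<longlongrightarrow> 0) (at 0)"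
proof -
  have "((\<lambda>t. inverse t ^ k / exp (inverse t)) \<longlongrightarrow> 0) (at_right (0::real))"
    by (rule filterlim_compose[OF tendsto_power_div_exp_0 filterlim_inverse_at_top_right])
  then have "(flat k \<longlongrightarrow> 0) (at_right 0)"
    by (rule Lim_transform_eventually)
      (auto simp: flat_def eventually_at_right_less exp_minus divide_inverse
        intro!: eventually_mono[OF eventually_at_right_less])
  moreover have "(flat k \<longlongrightarrow> 0) (at_left 0)"
    by (rule Lim_transform_eventually[OF tendsto_const])
      (auto simp: flat_def eventually_at_left_field intro: exI[of _ "-1"])
  ultimately show ?thesis by (simp add: filterlim_split_at)
qed

lemma DERIV_flat: "(flat k has_real_derivative flat (k + 2) t - real k * flat (k + 1) t) (at t)"
proof (cases t "0::real" rule: linorder_cases)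
  case less
  have "((\<lambda>x. 0) has_real_derivative 0) (at t)" by simp
  moreover have "eventually (\<lambda>x. flat k x = 0) (nhds t)"
    using order_tendstoD(2)[OF tendsto_ident_at less]
    by (auto simp: flat_def eventually_nhds intro!: exI[of _ "{..<0}"] less)
  ultimately have "(flat k has_real_derivative 0) (at t)"
    using DERIV_cong_ev[of t t "flat k" "\<lambda>x. 0" 0 0] by simp
  then show ?thesis using less by (simp add: flat_def)
next
  case equal
  have "((\<lambda>y. (flat k y - flat k 0) / (y - 0)) \<longlongrightarrow> 0) (at 0)"
    by (rule Lim_transform_eventually[OF flat_tendsto_0[of "Suc k"]])
      (auto simp: flat_def divide_inverse)
  then show ?thesis using equal by (simp add: flat_def has_field_derivative_iff)
next
  case greater
  have "((\<lambda>x. inverse x ^ k * exp (- inverse x)) has_real_derivative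
     flat (k + 2) t - real k * flat (k + 1) t) (at t)"
    using greater
    by (auto intro!: derivative_eq_intros simp: flat_def power2_eq_square algebra_simps)
      (cases k; simp add: algebra_simps)
  moreover have "eventually (\<lambda>x. flat k x = inverse x ^ k * exp (- inverse x)) (nhds t)"
    using greater by (auto simp: flat_def eventually_nhds intro!: exI[of _ "{0<..}"])
  ultimately show ?thesis
    using DERIV_cong_ev[of t t "flat k" "\<lambda>x. inverse x ^ k * exp (- inverse x)"] by blast
qed

lemma continuous_on_flat: "continuous_on S (flat k)"
  using DERIV_flat DERIV_isCont continuous_at_imp_continuous_on by blast

lemma flat_nonneg: "flat k t \<ge> 0"
  by (simp add: flat_def)

lemma flat_pos: "t > 0 \<Longrightarrow> flat k t > 0"
  by (simp add: flat_def)

lemma flat_0: "t \<le> 0 \<Longrightarrow> flat k t = 0"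
  by (simp add: flat_def)

lemma Ck_on_flat:
  assumes U: "open_eucl n U"
  shows "Ck_on k n U f \<Longrightarrow> Ck_on k n U (\<lambda>x. flat j (f x))"
proof (induction k arbitrary: j)
  case 0
  then show ?case using open_eucl_subset[OF U]
    by (simp add: continuous_map_eucl_iff continuous_on_compose2[OF continuous_on_flat[of UNIV]])
next
  case (Suc k)
  note f = Suc.prems(1)[unfolded Ck_on_Suc_partial_deriv[OF U]]
  show ?case
  proof (rule Ck_on_SucI[OF open_eucl_subset[OF U],
        where g = "\<lambda>i x. (flat (j + 2) (f x) + (- real j) * flat (j + 1) (f x)) * partial_deriv i f x"])
    show "continuous_on U (\<lambda>x. flat j (f x))"
      using f by (auto intro: continuous_on_compose2[OF continuous_on_flat[of UNIV]])
    show "((\<lambda>t. flat j (f (x(i := t)))) has_real_derivative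
        (flat (j + 2) (f x) + (- real j) * flat (j + 1) (f x)) * partial_deriv i f x) (at (x i))"
      if "i < n" "x \<in> U" for i x
      using DERIV_chain2[of "flat j" _ "\<lambda>t. f (x(i := t))", OF DERIV_flat] f that by fastforce
    show "Ck_on k n U (\<lambda>x. (flat (j + 2) (f x) + (- real j) * flat (j + 1) (f x)) * partial_deriv i f x)"
      if "i < n" for i
      using f that Suc.prems[THEN Ck_on_SucD] Suc.IH
      by (intro Ck_on_mult[OF U] Ck_on_add[OF U] Ck_on_const) auto
  qed
qed

section \<open>Smooth real functions and bump functions\<close>

text \<open>
  Smooth real-valued functions. Openness of the domain is part of the notion, since the calculus
  rules for \<^term>\<open>Ck_on\<close> are valid on open sets only.
\<close>

definition smooth_fun :: "nat \<Rightarrow> (nat \<Rightarrow> real) set \<Rightarrow> ((nat \<Rightarrow> real) \<Rightarrow> real) \<Rightarrow> bool" where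
  "smooth_fun n U f \<longleftrightarrow> open_eucl n U \<and> (\<forall>k. Ck_on k n U f)"

lemma open_eucl_eucl [simp]: "open_eucl n (eucl n)"
  by (metis openin_topspace topspace_Euclidean_space)

lemma smooth_fun_open: "smooth_fun n U f \<Longrightarrow> open_eucl n U"
  by (simp add: smooth_fun_def)

lemma smooth_fun_const: "open_eucl n U \<Longrightarrow> smooth_fun n U (\<lambda>x. c)"
  by (simp add: smooth_fun_def Ck_on_const)

lemma smooth_fun_coord: "open_eucl n U \<Longrightarrow> smooth_fun n U (\<lambda>x. x j)"
  by (simp add: smooth_fun_def Ck_on_coord open_eucl_subset)

lemma smooth_fun_add: "smooth_fun n U f \<Longrightarrow> smooth_fun n U g \<Longrightarrow> smooth_fun n U (\<lambda>x. f x + g x)"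
  by (simp add: smooth_fun_def Ck_on_add)

lemma smooth_fun_mult: "smooth_fun n U f \<Longrightarrow> smooth_fun n U g \<Longrightarrow> smooth_fun n U (\<lambda>x. f x * g x)"
  by (simp add: smooth_fun_def Ck_on_mult)

lemma smooth_fun_diff:
  assumes "smooth_fun n U f" "smooth_fun n U g"
  shows "smooth_fun n U (\<lambda>x. f x - g x)"
  using smooth_fun_add[OF assms(1)
      smooth_fun_mult[OF smooth_fun_const[OF smooth_fun_open[OF assms(1)], of "-1"] assms(2)]]
  by simp

lemma smooth_fun_power: "smooth_fun n U f \<Longrightarrow> smooth_fun n U (\<lambda>x. f x ^ k)"
  by (induction k) (simp_all add: smooth_fun_const smooth_fun_open smooth_fun_mult)

lemma smooth_fun_divide:
  assumes "smooth_fun n U f" "smooth_fun n U g" "\<And>x. x \<in> U \<Longrightarrow> g x \<noteq> 0"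
  shows "smooth_fun n U (\<lambda>x. f x / g x)"
proof -
  have "smooth_fun n U (\<lambda>x. inverse (g x))"
    using assms unfolding smooth_fun_def by (simp add: Ck_on_inverse)
  from smooth_fun_mult[OF assms(1) this] show ?thesis by (simp add: divide_inverse)
qed

lemma smooth_fun_sum:
  "open_eucl n U \<Longrightarrow> (\<And>a. a \<in> A \<Longrightarrow> smooth_fun n U (f a)) \<Longrightarrow> smooth_fun n U (\<lambda>x. \<Sum>a\<in>A. f a x)"
  by (induction A rule: infinite_finite_induct) (auto intro: smooth_fun_const smooth_fun_add)

lemma smooth_fun_prod:
  "open_eucl n U \<Longrightarrow> (\<And>a. a \<in> A \<Longrightarrow> smooth_fun n U (f a)) \<Longrightarrow> smooth_fun n U (\<lambda>x. \<Prod>a\<in>A. f a x)"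
  by (induction A rule: infinite_finite_induct) (auto intro: smooth_fun_const smooth_fun_mult)

lemma smooth_fun_flat: "smooth_fun n U f \<Longrightarrow> smooth_fun n U (\<lambda>x. flat j (f x))"
  by (simp add: smooth_fun_def Ck_on_flat)

lemma smooth_fun_compose:
  assumes "smooth_fun m V g" "open_eucl n U" "f ` U \<subseteq> V" "\<And>j. j < m \<Longrightarrow> smooth_fun n U (\<lambda>x. f x j)"
  shows "smooth_fun n U (\<lambda>x. g (f x))"
  using assms Ck_on_compose[OF assms(2) smooth_fun_open[OF assms(1)] assms(3)]
  unfolding smooth_fun_def by simp

lemma smooth_fun_subset: "smooth_fun n U f \<Longrightarrow> open_eucl n V \<Longrightarrow> V \<subseteq> U \<Longrightarrow> smooth_fun n V f"
  unfolding smooth_fun_def by (blast intro: Ck_on_subset)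

lemma smooth_fun_cong: "smooth_fun n U f \<Longrightarrow> (\<And>x. x \<in> U \<Longrightarrow> f x = g x) \<Longrightarrow> smooth_fun n U g"
  unfolding smooth_fun_def by (blast intro: Ck_on_cong)

lemma smooth_fun_local:
  assumes "\<And>x. x \<in> U \<Longrightarrow> \<exists>V. x \<in> V \<and> V \<subseteq> U \<and> smooth_fun n V f"
  shows "smooth_fun n U f"
proof -
  have op: "open_eucl n U"
  proof (rule open_euclI)
    show "U \<subseteq> eucl n"
      using assms smooth_fun_open open_eucl_subset by blast
    show "\<exists>V. open_eucl n V \<and> x \<in> V \<and> V \<subseteq> U" if "x \<in> U" for x
      using assms[OF that] smooth_fun_open by blast
  qed
  show ?thesis
    unfolding smooth_fun_def
  proof (intro conjI allI op)
    fix k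
    show "Ck_on k n U f"
    proof (rule Ck_on_local[OF op])
      fix x assume "x \<in> U"
      from assms[OF this] obtain V where "x \<in> V" "V \<subseteq> U" "smooth_fun n V f" by blast
      then show "\<exists>V. open_eucl n V \<and> x \<in> V \<and> V \<subseteq> U \<and> Ck_on k n V f"
        by (auto simp: smooth_fun_def)
    qed
  qed
qed

lemma smooth_fun_continuous: "smooth_fun n U f \<Longrightarrow> continuous_on U f"
  unfolding smooth_fun_def using Ck_on_continuous open_eucl_subset by blast

lemma open_eucl_preimage:
  assumes "smooth_fun n U f" "open T"
  shows "open_eucl n {x \<in> U. f x \<in> T}"
proof -
  have "openin (top_of_set U) (U \<inter> f -` T)"
    using assms by (intro continuous_openin_preimage_gen smooth_fun_continuous)
  moreover have "U \<inter> f -` T = {x \<in> U. f x \<in> T}" by auto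
  ultimately show ?thesis
    using openin_trans[OF _ smooth_fun_open[OF assms(1), unfolded Euclidean_space_eq]]
    unfolding Euclidean_space_eq by simp
qed

lemma smooth_on_iff:
  "open_eucl n U \<Longrightarrow> smooth_on n U m f \<longleftrightarrow> f ` U \<subseteq> eucl m \<and> (\<forall>j<m. smooth_fun n U (\<lambda>x. f x j))"
  by (auto simp: smooth_on_def smooth_fun_def topspace_Euclidean_space)

lemma smooth_fun_sqdist: "smooth_fun n (eucl n) (\<lambda>x. \<Sum>j<n. (x j - p j)\<^sup>2)"
  by (intro smooth_fun_sum smooth_fun_power smooth_fun_diff smooth_fun_coord smooth_fun_const
      open_eucl_eucl)

text \<open>
  The set \<open>S\<close> contains the support of the bump function \<open>\<rho>\<close>, and \<open>B'\<close> is a neighbourhood of \<open>p\<close> on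
  which \<open>\<rho>\<close> is constantly one.
\<close>

lemma smooth_bump:
  assumes B: "open_eucl n B" "p \<in> B"
  obtains \<rho> B' S where "smooth_fun n (eucl n) \<rho>" "\<And>x. 0 \<le> \<rho> x" "\<And>x. \<rho> x \<le> 1"
    "open_eucl n B'" "p \<in> B'" "B' \<subseteq> S" "S \<subseteq> B" "open_eucl n (eucl n - S)"
    "\<And>x. x \<in> B' \<Longrightarrow> \<rho> x = 1" "\<And>x. x \<in> eucl n - S \<Longrightarrow> \<rho> x = 0"
proof -
  obtain e where e: "e > 0" "cube n p e \<subseteq> B" using B open_eucl_cubeE by metis
  define q where "q = (\<lambda>x::nat\<Rightarrow>real. \<Sum>j<n. (x j - p j)\<^sup>2)"
  define a where "a = e\<^sup>2 / 8"
  define b where "b = e\<^sup>2 / 4"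
  have ab: "0 < a" "a < b" using e(1) by (auto simp: a_def b_def)
  define \<rho> where "\<rho> x = flat 0 (b - q x) / (flat 0 (b - q x) + flat 0 (q x - a))" for x
  \<comment> \<open>The two summands do not vanish simultaneously, as \<open>a < b\<close>.\<close>
  have pos: "flat 0 (b - t) + flat 0 (t - a) > 0" for t
    using ab flat_pos[of "b - t" 0] flat_pos[of "t - a" 0] flat_nonneg[of 0 "b - t"] flat_nonneg[of 0 "t - a"]
    by (cases "t < b") (auto intro: add_pos_nonneg add_nonneg_pos)
  have q: "smooth_fun n (eucl n) q" unfolding q_def by (rule smooth_fun_sqdist)
  define B' where "B' = {x \<in> eucl n. q x \<in> {..<a}}"
  define S where "S = {x \<in> eucl n. q x \<le> b}"
  show thesis
  proof
    show "smooth_fun n (eucl n) \<rho>"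
      unfolding \<rho>_def using pos
      by (intro smooth_fun_divide smooth_fun_add smooth_fun_flat smooth_fun_diff q smooth_fun_const
          open_eucl_eucl) (metis less_irrefl)
    show "0 \<le> \<rho> x" "\<rho> x \<le> 1" for x
      using pos[of "q x"] flat_nonneg[of 0 "b - q x"] flat_nonneg[of 0 "q x - a"] by (auto simp: \<rho>_def)
    show "open_eucl n B'" unfolding B'_def by (rule open_eucl_preimage[OF q]) simp
    show "p \<in> B'" using B ab open_eucl_subset by (auto simp: B'_def q_def)
    show "B' \<subseteq> S" using ab by (auto simp: B'_def S_def)
    show "S \<subseteq> B"
    proof
      fix x assume x: "x \<in> S"
      have "\<bar>x j - p j\<bar> < e" if "j < n" for j
      proof -
        have "(x j - p j)\<^sup>2 \<le> q x" unfolding q_def using that by (intro member_le_sum) auto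
        also have "\<dots> \<le> e\<^sup>2 / 4" using x by (simp add: S_def b_def)
        also have "\<dots> < e\<^sup>2" using e(1) by simp
        finally show ?thesis
          using e(1) power_less_imp_less_base[of "\<bar>x j - p j\<bar>" 2 e] by simp
      qed
      then show "x \<in> B" using x e(2) by (auto simp: cube_def S_def)
    qed
    have "eucl n - S = {x \<in> eucl n. q x \<in> {b<..}}" by (auto simp: S_def)
    then show "open_eucl n (eucl n - S)" using open_eucl_preimage[OF q, of "{b<..}"] by simp
    show "\<rho> x = 1" if "x \<in> B'" for x
      using that pos[of "q x"] flat_0[of "q x - a" 0] by (simp add: \<rho>_def B'_def)
    show "\<rho> x = 0" if "x \<in> eucl n - S" for x
      using that flat_0[of "b - q x" 0] by (auto simp: \<rho>_def S_def)
  qed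
qed

section \<open>Smooth maps into a manifold\<close>

lemma topspace_sub_eucl: "U \<subseteq> eucl n \<Longrightarrow> topspace (subtopology (Euclidean_space n) U) = U"
  by (auto simp: topspace_Euclidean_space)

lemma continuous_preimage_open:
  assumes "open_eucl n U" "continuous_map (subtopology (Euclidean_space n) U) M p" "openin M V"
  shows "open_eucl n {u \<in> U. p u \<in> V}"
  using openin_trans_full[OF openin_continuous_map_preimage[OF assms(2,3)] assms(1)]
  unfolding topspace_sub_eucl[OF open_eucl_subset[OF assms(1)]] .

lemma continuous_map_eucl_coord:
  assumes "open_eucl m W" "f ` W \<subseteq> U" "U \<subseteq> eucl n" "\<And>j. j < n \<Longrightarrow> smooth_fun m W (\<lambda>x. f x j)"
  shows "continuous_map (subtopology (Euclidean_space m) W) (subtopology (Euclidean_space n) U) f"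
proof -
  have "continuous_on W f"
    using assms(2,3) smooth_fun_continuous[OF assms(4)]
    by (intro continuous_on_into_eucl[where m = n]) blast+
  then show ?thesis using assms open_eucl_subset[OF assms(1)]
    by (auto simp: Euclidean_space_eq subtopology_subtopology Int_absorb1 continuous_map_in_subtopology
        continuous_map_iff_continuous)
qed

context smooth_manifold
begin

text \<open>
  Smooth maps from an open set into the manifold. Up to extensionality these are the plots of the
  standard diffeology (\<open>plots_iff\<close> below).
\<close>

definition smooth_into :: "nat \<Rightarrow> (nat \<Rightarrow> real) set \<Rightarrow> ((nat \<Rightarrow> real) \<Rightarrow> 'a) \<Rightarrow> bool" where
  "smooth_into n U p \<longleftrightarrow> open_eucl n U \<and> continuous_map (subtopology (Euclidean_space n) U) M p \<and>
     (\<forall>(V, \<phi>)\<in>\<A>. \<forall>j<d. smooth_fun n {u \<in> U. p u \<in> V} (\<lambda>u. \<phi> (p u) j))"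

lemma smooth_into_open: "smooth_into n U p \<Longrightarrow> open_eucl n U"
  by (simp add: smooth_into_def)

lemma smooth_into_preimage:
  "smooth_into n U p \<Longrightarrow> openin M V \<Longrightarrow> open_eucl n {u \<in> U. p u \<in> V}"
  unfolding smooth_into_def using continuous_preimage_open by blast

lemma smooth_into_points:
  assumes "smooth_into n U p" "u \<in> U"
  shows "p u \<in> topspace M"
proof -
  have "topspace (subtopology (Euclidean_space n) U) = U"
    by (rule topspace_sub_eucl[OF open_eucl_subset[OF smooth_into_open[OF assms(1)]]])
  then show ?thesis using assms unfolding smooth_into_def
    by (metis continuous_map_image_subset_topspace image_subset_iff)
qed

lemma smooth_into_chart:
  "smooth_into n U p \<Longrightarrow> (V, \<phi>) \<in> \<A> \<Longrightarrow> j < d \<Longrightarrow> smooth_fun n {u \<in> U. p u \<in> V} (\<lambda>u. \<phi> (p u) j)"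
  unfolding smooth_into_def by blast

lemma chart_in_eucl: "(V, \<phi>) \<in> \<A> \<Longrightarrow> y \<in> V \<Longrightarrow> \<phi> y \<in> eucl d"
  using chart_image open_eucl_subset by blast

lemma plots_iff:
  "p \<in> plots (manifold_diffeology d M \<A>) n U \<longleftrightarrow> p \<in> extensional U \<and> smooth_into n U p"
proof -
  have "smooth_on n {u \<in> U. p u \<in> V} d (\<lambda>u. \<phi> (p u)) \<longleftrightarrow> (\<forall>j<d. smooth_fun n {u \<in> U. p u \<in> V} (\<lambda>u. \<phi> (p u) j))"
    if "(V, \<phi>) \<in> \<A>" "open_eucl n U" "continuous_map (subtopology (Euclidean_space n) U) M p" for V \<phi>
  proof (subst smooth_on_iff)
    show "open_eucl n {u \<in> U. p u \<in> V}"
      using continuous_preimage_open[OF that(2,3) chart_domain[OF that(1)]] .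
  qed (use chart_in_eucl[OF that(1)] in auto)
  moreover have "p \<in> U \<rightarrow>\<^sub>E topspace M \<longleftrightarrow> p \<in> extensional U"
    if "smooth_into n U p" using smooth_into_points[OF that] by (auto simp: PiE_def)
  ultimately show ?thesis
    unfolding manifold_diffeology_def smooth_into_def by (auto simp: PiE_def)
qed

lemma smooth_into_subset:
  assumes "smooth_into n U p" "open_eucl n U'" "U' \<subseteq> U"
  shows "smooth_into n U' p"
proof -
  have cont: "continuous_map (subtopology (Euclidean_space n) U') M p"
    using assms unfolding smooth_into_def by (meson continuous_map_from_subtopology_mono)
  have "smooth_fun n {u \<in> U'. p u \<in> V} (\<lambda>u. \<phi> (p u) j)" if "(V, \<phi>) \<in> \<A>" "j < d" for V \<phi> j
    by (rule smooth_fun_subset[OF smooth_into_chart[OF assms(1) that]])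
      (use continuous_preimage_open[OF assms(2) cont chart_domain[OF that(1)]] assms(3) in auto)
  with cont assms(2) show ?thesis unfolding smooth_into_def by blast
qed

lemma smooth_into_cong:
  assumes "smooth_into n U p" "\<And>u. u \<in> U \<Longrightarrow> p u = p' u"
  shows "smooth_into n U p'"
proof -
  have cont: "continuous_map (subtopology (Euclidean_space n) U) M p'"
    using assms unfolding smooth_into_def by (elim conjE continuous_map_eq) auto
  have "{u \<in> U. p' u \<in> V} = {u \<in> U. p u \<in> V}" for V using assms(2) by auto
  then have "smooth_fun n {u \<in> U. p' u \<in> V} (\<lambda>u. \<phi> (p' u) j)" if "(V, \<phi>) \<in> \<A>" "j < d" for V \<phi> j
    using smooth_fun_cong[OF smooth_into_chart[OF assms(1) that], of "\<lambda>u. \<phi> (p' u) j"] assms(2) by auto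
  with cont assms(1) show ?thesis unfolding smooth_into_def by blast
qed

lemma smooth_into_local:
  assumes "\<And>u. u \<in> U \<Longrightarrow> \<exists>W. u \<in> W \<and> W \<subseteq> U \<and> smooth_into n W p"
  shows "smooth_into n U p"
proof -
  have U: "open_eucl n U"
  proof (rule open_euclI)
    show "U \<subseteq> eucl n"
      using assms smooth_into_open open_eucl_subset by blast
    show "\<exists>V. open_eucl n V \<and> x \<in> V \<and> V \<subseteq> U" if "x \<in> U" for x
      using assms[OF that] smooth_into_open by blast
  qed
  have cont: "continuous_map (subtopology (Euclidean_space n) U) M p"
    unfolding continuous_map_def
  proof (intro conjI allI impI)
    show "p \<in> topspace (subtopology (Euclidean_space n) U) \<rightarrow> topspace M"
      unfolding topspace_sub_eucl[OF open_eucl_subset[OF U]]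
    proof
      fix u assume "u \<in> U"
      from assms[OF this] obtain W where "u \<in> W" "smooth_into n W p" by blast
      then show "p u \<in> topspace M" by (metis smooth_into_points)
    qed
  next
    fix T assume T: "openin M T"
    have "open_eucl n {u \<in> U. p u \<in> T}"
    proof (rule open_euclI)
      fix u assume u: "u \<in> {u \<in> U. p u \<in> T}"
      then obtain W where W: "u \<in> W" "W \<subseteq> U" "smooth_into n W p"
        using assms[of u] by blast
      then show "\<exists>V. open_eucl n V \<and> u \<in> V \<and> V \<subseteq> {u \<in> U. p u \<in> T}"
        using smooth_into_preimage[OF W(3) T] u by blast
    qed (use open_eucl_subset[OF U] in auto)
    then show "openin (subtopology (Euclidean_space n) U)
        {u \<in> topspace (subtopology (Euclidean_space n) U). p u \<in> T}"
      unfolding topspace_sub_eucl[OF open_eucl_subset[OF U]]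
      using U by (subst openin_open_subtopology) auto
  qed
  have "smooth_fun n {u \<in> U. p u \<in> V} (\<lambda>u. \<phi> (p u) j)" if "(V, \<phi>) \<in> \<A>" "j < d" for V \<phi> j
  proof (rule smooth_fun_local)
    fix u assume u: "u \<in> {u \<in> U. p u \<in> V}"
    then obtain W where W: "u \<in> W" "W \<subseteq> U" "smooth_into n W p"
        using assms[of u] by blast
    show "\<exists>W. u \<in> W \<and> W \<subseteq> {u \<in> U. p u \<in> V} \<and> smooth_fun n W (\<lambda>u. \<phi> (p u) j)"
      using smooth_into_chart[OF W(3) that] u W by (intro exI[of _ "{u \<in> W. p u \<in> V}"]) auto
  qed
  with cont U show ?thesis unfolding smooth_into_def by blast
qed

lemma smooth_into_compose:
  assumes p: "smooth_into n U p" and W: "open_eucl m W" and f: "f ` W \<subseteq> U"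
    "\<And>j. j < n \<Longrightarrow> smooth_fun m W (\<lambda>x. f x j)"
  shows "smooth_into m W (\<lambda>x. p (f x))"
proof -
  have U: "U \<subseteq> eucl n" using p smooth_into_open open_eucl_subset by blast
  have cont: "continuous_map (subtopology (Euclidean_space m) W) M (\<lambda>x. p (f x))"
    using continuous_map_compose[OF continuous_map_eucl_coord[OF W f(1) U f(2)]] p
    unfolding smooth_into_def comp_def by blast
  have "smooth_fun m {x \<in> W. p (f x) \<in> V} (\<lambda>x. \<phi> (p (f x)) j)" if "(V, \<phi>) \<in> \<A>" "j < d" for V \<phi> j
  proof -
    have op: "open_eucl m {x \<in> W. p (f x) \<in> V}"
      by (rule continuous_preimage_open[OF W cont chart_domain[OF that(1)]])
    show ?thesis
      by (rule smooth_fun_compose[OF smooth_into_chart[OF p that] op])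
        (use f smooth_fun_subset[OF f(2) op] in auto)
  qed
  with cont W show ?thesis unfolding smooth_into_def by blast
qed

lemma chart_inj: "(V, \<phi>) \<in> \<A> \<Longrightarrow> inj_on \<phi> V"
  using homeomorphic_imp_injective_map[OF chart_homeomorphic[of V \<phi>]]
    topspace_subtopology_subset[OF openin_subset[OF chart_domain[of V \<phi>]]] by simp

lemma chart_inverse_continuous:
  assumes "(V, \<phi>) \<in> \<A>"
  shows "continuous_map (subtopology (Euclidean_space d) (\<phi> ` V)) M (inv_into V \<phi>)"
proof -
  have V: "topspace (subtopology M V) = V"
    using openin_subset[OF chart_domain[OF assms]] by (metis topspace_subtopology_subset)
  have V': "topspace (subtopology (Euclidean_space d) (\<phi> ` V)) = \<phi> ` V"
    using topspace_sub_eucl[OF open_eucl_subset[OF chart_image[OF assms]]] .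
  obtain g where g: "homeomorphic_maps (subtopology M V) (subtopology (Euclidean_space d) (\<phi> ` V)) \<phi> g"
    using chart_homeomorphic[OF assms] homeomorphic_map_maps by blast
  then have "continuous_map (subtopology (Euclidean_space d) (\<phi> ` V)) (subtopology M V) g"
    by (simp add: homeomorphic_maps_def)
  then have "continuous_map (subtopology (Euclidean_space d) (\<phi> ` V)) M g"
    using continuous_map_into_fulltopology by blast
  moreover have "g y = inv_into V \<phi> y" if "y \<in> \<phi> ` V" for y
    using that g chart_inj[OF assms] unfolding homeomorphic_maps_def V by auto
  ultimately show ?thesis by (rule continuous_map_eq) (simp add: V')
qed

lemma chart_overlap_open:
  assumes "(V, \<phi>) \<in> \<A>" "(W, \<psi>) \<in> \<A>"
  shows "open_eucl d (\<phi> ` (V \<inter> W))"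
proof -
  have "openin (subtopology M V) (V \<inter> W)"
    using chart_domain[OF assms(2)] by (auto simp: openin_subtopology)
  then have "openin (subtopology (Euclidean_space d) (\<phi> ` V)) (\<phi> ` (V \<inter> W))"
    using homeomorphic_imp_open_map[OF chart_homeomorphic[OF assms(1)]] unfolding open_map_def by blast
  then show ?thesis using chart_image[OF assms(1)] openin_trans_full by blast
qed

text \<open>
  Smoothness in a single chart suffices, because the transition maps are smooth.
\<close>

lemma smooth_into_from_chart:
  assumes chart: "(V, \<phi>) \<in> \<A>" and U: "open_eucl n U" and g: "g ` U \<subseteq> \<phi> ` V"
    "\<And>j. j < d \<Longrightarrow> smooth_fun n U (\<lambda>u. g u j)"
  shows "smooth_into n U (\<lambda>u. inv_into V \<phi> (g u))"
proof -
  have cont: "continuous_map (subtopology (Euclidean_space n) U) M (\<lambda>u. inv_into V \<phi> (g u))"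
    using continuous_map_compose[OF continuous_map_eucl_coord[OF U g(1) open_eucl_subset[OF chart_image[OF chart]] g(2)]
        chart_inverse_continuous[OF chart]]
    by (simp add: comp_def)
  have "smooth_fun n {u \<in> U. inv_into V \<phi> (g u) \<in> W} (\<lambda>u. \<psi> (inv_into V \<phi> (g u)) j)"
    if W: "(W, \<psi>) \<in> \<A>" and j: "j < d" for W \<psi> j
  proof -
    have op: "open_eucl n {u \<in> U. inv_into V \<phi> (g u) \<in> W}"
      by (rule continuous_preimage_open[OF U cont chart_domain[OF W]])
    have "smooth_fun d (\<phi> ` (V \<inter> W)) (\<lambda>x. \<psi> (inv_into V \<phi> x) j)"
      using transition_smooth[OF chart W] j by (simp add: smooth_on_iff[OF chart_overlap_open[OF chart W]])
    moreover have "g ` {u \<in> U. inv_into V \<phi> (g u) \<in> W} \<subseteq> \<phi> ` (V \<inter> W)"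
    proof
      fix y assume "y \<in> g ` {u \<in> U. inv_into V \<phi> (g u) \<in> W}"
      then obtain u where u: "u \<in> U" "inv_into V \<phi> (g u) \<in> W" "y = g u" by blast
      then have "g u \<in> \<phi> ` V" using g(1) by blast
      then have "inv_into V \<phi> (g u) \<in> V" "\<phi> (inv_into V \<phi> (g u)) = g u"
        by (auto intro: inv_into_into f_inv_into_f)
      then show "y \<in> \<phi> ` (V \<inter> W)" using u by (metis IntI image_eqI)
    qed
    ultimately show ?thesis
      by (rule smooth_fun_compose[OF _ op]) (use smooth_fun_subset[OF g(2) op] in auto)
  qed
  with cont U show ?thesis unfolding smooth_into_def by blast
qed

lemma smooth_into_const:
  assumes U: "open_eucl n U" and c: "c \<in> topspace M"
  shows "smooth_into n U (\<lambda>u. c)"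
proof -
  have "smooth_fun n {u \<in> U. c \<in> V} (\<lambda>u. \<phi> c j)" for V \<phi> j
    by (rule smooth_fun_const) (use U in \<open>cases "c \<in> V"; simp\<close>)
  then show ?thesis using U c unfolding smooth_into_def by auto
qed

theorem manifold_diffeological_space: "diffeological_space (manifold_diffeology d M \<A>)"
proof
  have pts: "points (manifold_diffeology d M \<A>) = topspace M"
    by (simp add: manifold_diffeology_def)
  show "open_eucl n U" if "p \<in> plots (manifold_diffeology d M \<A>) n U" for p n U
    using that unfolding plots_iff smooth_into_def by blast
  show "p \<in> U \<rightarrow>\<^sub>E points (manifold_diffeology d M \<A>)"
    if "p \<in> plots (manifold_diffeology d M \<A>) n U" for p n U
    using that smooth_into_points unfolding plots_iff pts by (auto simp: PiE_def)
  show "(\<lambda>u\<in>U. c) \<in> plots (manifold_diffeology d M \<A>) n U"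
    if "open_eucl n U" "c \<in> points (manifold_diffeology d M \<A>)" for n U c
    using smooth_into_cong[OF smooth_into_const[of n U c], of "\<lambda>u\<in>U. c"] that
    unfolding plots_iff pts by auto
  show "compose V p f \<in> plots (manifold_diffeology d M \<A>) m V"
    if "p \<in> plots (manifold_diffeology d M \<A>) n U" "open_eucl m V" "f \<in> V \<rightarrow> U" "smooth_on m V n f"
    for p n U m V f
  proof -
    have "smooth_into m V (\<lambda>x. p (f x))"
      by (rule smooth_into_compose[of n U])
        (use that in \<open>auto simp: plots_iff smooth_on_iff[OF that(2)]\<close>)
    then have "smooth_into m V (compose V p f)"
      by (rule smooth_into_cong) (simp add: compose_def)
    then show ?thesis unfolding plots_iff by (simp add: compose_def)
  qed
  show "p \<in> plots (manifold_diffeology d M \<A>) n U"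
    if "p \<in> U \<rightarrow>\<^sub>E points (manifold_diffeology d M \<A>)" "\<forall>V\<in>\<V>. open_eucl n V" "\<Union>\<V> = U"
      "\<forall>V\<in>\<V>. restrict p V \<in> plots (manifold_diffeology d M \<A>) n V" for p U \<V> n
  proof -
    have "smooth_into n V p" if "V \<in> \<V>" for V
    proof -
      have "smooth_into n V (restrict p V)" using that \<open>\<forall>V\<in>\<V>. restrict p V \<in> _\<close> unfolding plots_iff by blast
      then show ?thesis by (rule smooth_into_cong) simp
    qed
    then have "smooth_into n U p" using that(3) by (intro smooth_into_local[of U]) blast
    then show ?thesis using that(1) unfolding plots_iff by (simp add: PiE_def)
  qed
qed

end

section \<open>Extending a partial extension near a point\<close>

lemma smooth_fun_zero_coord:
  assumes "smooth_fun n U g" "\<And>x. x \<in> U \<Longrightarrow> x(i := 0) \<in> U"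
  shows "smooth_fun n U (\<lambda>x. g (x(i := 0)))"
proof (rule smooth_fun_compose[OF assms(1) smooth_fun_open[OF assms(1)]])
  show "(\<lambda>x. x(i := 0)) ` U \<subseteq> U" using assms(2) by blast
  show "smooth_fun n U (\<lambda>x. (x(i := 0)) j)" for j
    using smooth_fun_open[OF assms(1)] by (cases "j = i") (simp_all add: smooth_fun_const smooth_fun_coord)
qed

text \<open>
  The real-valued case. The correction term \<open>(g\<^sub>i - G) \<circ> z\<^sub>i\<close> produces the right values for
  \<open>x\<^sub>i = 0\<close> and, by compatibility, vanishes on the hyperplanes treated before.
\<close>

lemma smooth_extension_from_hyperplanes:
  assumes "finite J" "open_eucl n O'"
    "\<And>x i. x \<in> O' \<Longrightarrow> i \<in> J \<Longrightarrow> x(i := 0) \<in> O'"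
    "\<And>i. i \<in> J \<Longrightarrow> smooth_fun n O' (g i)"
    "\<And>i j x. i \<in> J \<Longrightarrow> j \<in> J \<Longrightarrow> x \<in> O' \<Longrightarrow> x i = 0 \<Longrightarrow> x j = 0 \<Longrightarrow> g i x = g j x"
  obtains G where "smooth_fun n O' G" "\<And>i x. i \<in> J \<Longrightarrow> x \<in> O' \<Longrightarrow> x i = 0 \<Longrightarrow> G x = g i x"
proof -
  have "\<exists>G. smooth_fun n O' G \<and> (\<forall>i\<in>J. \<forall>x\<in>O'. x i = 0 \<longrightarrow> G x = g i x)"
    using assms
  proof (induction J rule: finite_induct)
    case empty
    then show ?case by (intro exI[of _ "\<lambda>x. 0"]) (simp add: smooth_fun_const)
  next
    case (insert i J)
    have "\<exists>G. smooth_fun n O' G \<and> (\<forall>i\<in>J. \<forall>x\<in>O'. x i = 0 \<longrightarrow> G x = g i x)"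
    proof (rule insert.IH[OF insert.prems(1)])
      show "x(j := 0) \<in> O'" if "x \<in> O'" "j \<in> J" for x j
        by (rule insert.prems(2)[OF that(1) insertI2[OF that(2)]])
      show "smooth_fun n O' (g j)" if "j \<in> J" for j
        by (rule insert.prems(3)[OF insertI2[OF that]])
      show "g j x = g k x" if "j \<in> J" "k \<in> J" "x \<in> O'" "x j = 0" "x k = 0" for j k x
        by (rule insert.prems(4)[OF insertI2[OF that(1)] insertI2[OF that(2)] that(3-5)])
    qed
    then obtain G where G: "smooth_fun n O' G"
        "\<And>j x. j \<in> J \<Longrightarrow> x \<in> O' \<Longrightarrow> x j = 0 \<Longrightarrow> G x = g j x"
      by blast
    define G' where "G' x = G x + (g i (x(i := 0)) - G (x(i := 0)))" for x
    have stable: "\<And>x. x \<in> O' \<Longrightarrow> x(i := 0) \<in> O'" by (rule insert.prems(2)[OF _ insertI1])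
    have gi: "smooth_fun n O' (g i)" by (rule insert.prems(3)[OF insertI1])
    have "smooth_fun n O' G'" unfolding G'_def
      by (intro smooth_fun_add smooth_fun_diff G(1) smooth_fun_zero_coord gi stable)
    moreover have "G' x = g j x" if j: "j \<in> insert i J" and x: "x \<in> O'" "x j = 0" for j x
    proof (cases "j = i")
      case True
      then have "x(i := 0) = x" using x by (auto simp: fun_eq_iff)
      then show ?thesis using True by (simp add: G'_def)
    next
      case False
      then have jJ: "j \<in> J" using j by blast
      have "G (x(i := 0)) = g j (x(i := 0))"
        using G(2)[OF jJ stable[OF x(1)]] x False by simp
      also have "\<dots> = g i (x(i := 0))"
        using x(2) False by (intro insert.prems(4)[OF j insertI1 stable[OF x(1)]]) simp_all
      finally show ?thesis using G(2)[OF jJ x] by (simp add: G'_def)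
    qed
    ultimately show ?case by blast
  qed
  with that show thesis by blast
qed

lemma open_eucl_preimage_eucl:
  assumes "open_eucl n U" "h ` U \<subseteq> eucl m" "\<And>j. j < m \<Longrightarrow> smooth_fun n U (\<lambda>x. h x j)" "open_eucl m Q"
  shows "open_eucl n {x \<in> U. h x \<in> Q}"
proof -
  have "continuous_on U h"
    using assms(2) smooth_fun_continuous[OF assms(3)] by (intro continuous_on_into_eucl[where m = m]) blast+
  moreover obtain T where T: "open T" "Q = eucl m \<inter> T"
    using assms(4) unfolding Euclidean_space_eq openin_open by blast
  ultimately have "openin (top_of_set U) (U \<inter> h -` T)"
    by (intro continuous_openin_preimage_gen)
  moreover have "U \<inter> h -` T = {x \<in> U. h x \<in> Q}" using T assms(2) by blast
  ultimately show ?thesis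
    using openin_trans[OF _ assms(1)[unfolded Euclidean_space_eq]]
    unfolding Euclidean_space_eq by simp
qed

text \<open>
  A compatible family of smooth maps on coordinate hyperplanes of the \<open>N\<close>-dimensional space. Each
  \<open>f i\<close> is defined and smooth on the whole space, but only its restriction to \<open>x\<^sub>i = 0\<close> matters; this
  avoids a separate notion of smoothness on a hyperplane.
\<close>

locale hyperplane_data = smooth_manifold d M \<A>
  for d :: nat and M :: "'a topology" and \<A> :: "('a set \<times> ('a \<Rightarrow> nat \<Rightarrow> real)) set" +
  fixes N :: nat and I :: "nat set" and f :: "nat \<Rightarrow> (nat \<Rightarrow> real) \<Rightarrow> 'a"
  assumes I_bound: "I \<subseteq> {..<N}"
    and f_smooth: "i \<in> I \<Longrightarrow> smooth_into N (eucl N) (f i)"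
    and f_compatible:
      "\<lbrakk>i \<in> I; j \<in> I; x \<in> eucl N; x i = 0; x j = 0\<rbrakk> \<Longrightarrow> f i x = f j x"
begin

text \<open>The union of the hyperplanes.\<close>

definition hyper :: "(nat \<Rightarrow> real) set" where
  "hyper = {x \<in> eucl N. \<exists>i\<in>I. x i = 0}"

text \<open>
  Smooth maps on an open set \<open>U\<close> that have the prescribed values on the part of the hyperplanes
  contained in \<open>U\<close>.
\<close>

definition partial_ext :: "(nat \<Rightarrow> real) set \<Rightarrow> ((nat \<Rightarrow> real) \<Rightarrow> 'a) \<Rightarrow> bool" where
  "partial_ext U F \<longleftrightarrow> smooth_into N U F \<and> (\<forall>i\<in>I. \<forall>x\<in>U. x i = 0 \<longrightarrow> F x = f i x)"

text \<open>
  Every partial extension can be changed within \<open>B\<close> so that its domain contains the part of the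
  hyperplanes that lies in \<open>K\<close>, and still contains the part that it contained before. The domain
  may lose other points, but outside \<open>B\<close> neither the domain nor the map changes.
\<close>

definition extends_over :: "(nat \<Rightarrow> real) set \<Rightarrow> (nat \<Rightarrow> real) set \<Rightarrow> bool" where
  "extends_over B K \<longleftrightarrow> (\<forall>U F. partial_ext U F \<longrightarrow>
     (\<exists>U' F'. partial_ext U' F' \<and> U \<inter> hyper \<subseteq> U' \<and> K \<inter> hyper \<subseteq> U' \<and>
        (\<forall>x\<in>eucl N - B. (x \<in> U' \<longleftrightarrow> x \<in> U) \<and> F' x = F x)))"

lemma finite_I: "finite I"
  using I_bound finite_subset by blast

text \<open>
  Near a point \<open>p\<close> of the hyperplanes there is a partial extension \<open>\<phi>\<^sup>-\<^sup>1 \<circ> G\<close>, given in a chart \<open>\<phi>\<close>,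
  with coordinates in a convex open set \<open>Q\<close>.
\<close>

lemma local_chart_extension:
  assumes p: "p \<in> hyper" and B0: "open_eucl N B0" "p \<in> B0"
  obtains V \<phi> Q G B where "(V, \<phi>) \<in> \<A>" "open_eucl d Q" "Q \<subseteq> \<phi> ` V"
    "\<And>y z t. y \<in> Q \<Longrightarrow> z \<in> Q \<Longrightarrow> 0 \<le> t \<Longrightarrow> t \<le> 1 \<Longrightarrow> (\<lambda>j. y j + t * (z j - y j)) \<in> Q"
    "open_eucl N B" "p \<in> B" "B \<subseteq> B0" "G ` B \<subseteq> Q" "\<And>j. j < d \<Longrightarrow> smooth_fun N B (\<lambda>x. G x j)"
    "\<And>i x. i \<in> I \<Longrightarrow> x \<in> B \<Longrightarrow> x i = 0 \<Longrightarrow> f i x \<in> V \<and> G x = \<phi> (f i x)"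
proof -
  have pE: "p \<in> eucl N" using p unfolding hyper_def by blast
  \<comment> \<open>Near \<open>p\<close> only the hyperplanes through \<open>p\<close> are relevant.\<close>
  define J where "J = {i \<in> I. p i = 0}"
  have finJ: "finite J" unfolding J_def using finite_I by simp
  obtain i0 where i0: "i0 \<in> J" using p unfolding hyper_def J_def by blast
  define m where "m = f i0 p"
  have fJ: "f i p = m" if "i \<in> J" for i
    unfolding m_def by (rule f_compatible) (use that i0 pE in \<open>auto simp: J_def\<close>)
  have "m \<in> topspace M"
    unfolding m_def by (rule smooth_into_points[OF f_smooth pE]) (use i0 J_def in simp)
  then obtain V \<phi> where chart: "(V, \<phi>) \<in> \<A>" "m \<in> V"
    using charts_cover by blast
  then obtain e where e: "e > 0" "cube d (\<phi> m) e \<subseteq> \<phi> ` V"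
    using open_eucl_cubeE[OF chart_image[OF chart(1)], of "\<phi> m"] by blast
  define Q where "Q = cube d (\<phi> m) e"
  have phim: "\<phi> m \<in> eucl d" by (rule chart_in_eucl[OF chart])
  define O1 where "O1 = B0 \<inter> (\<Inter>i\<in>J. {x \<in> eucl N. f i x \<in> V}) \<inter> (\<Inter>i\<in>I - J. {x \<in> eucl N. x i \<in> - {0}})"
  have O1a: "open_eucl N (X \<inter> (\<Inter>i\<in>J'. Y i))" if "finite J'" "open_eucl N X" "\<And>i. i \<in> J' \<Longrightarrow> open_eucl N (Y i)"
    for X :: "(nat \<Rightarrow> real) set" and Y :: "nat \<Rightarrow> (nat \<Rightarrow> real) set" and J'
    using that
  proof (induction J' rule: finite_induct)
    case (insert i J')
    have "open_eucl N (X \<inter> (\<Inter>i\<in>J'. Y i))"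
      by (rule insert.IH[OF insert.prems(1)]) (rule insert.prems(2)[OF insertI2])
    then have "open_eucl N (Y i \<inter> (X \<inter> (\<Inter>i\<in>J'. Y i)))"
      by (rule openin_Int[OF insert.prems(2)[OF insertI1]])
    then show ?case by (simp add: Int_left_commute)
  qed auto
  have "open_eucl N O1"
    unfolding O1_def
  proof (intro O1a finJ B0(1))
    show "open_eucl N {x \<in> eucl N. f i x \<in> V}" if "i \<in> J" for i
      using smooth_into_preimage[OF f_smooth chart_domain[OF chart(1)]] that unfolding J_def by blast
    show "open_eucl N {x \<in> eucl N. x i \<in> - {0}}" for i
      by (rule open_eucl_preimage[OF smooth_fun_coord]) auto
  qed (use finite_I in simp)
  moreover have "p \<in> O1"
    using B0(2) pE fJ chart(2) unfolding O1_def J_def by auto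
  ultimately obtain \<delta> where \<delta>: "\<delta> > 0" "cube N p \<delta> \<subseteq> O1"
    using open_eucl_cubeE by metis
  define O' where "O' = cube N p \<delta>"
  have O': "open_eucl N O'" unfolding O'_def by (rule open_eucl_cube)
  have "O' \<subseteq> O1" using \<delta>(2) by (simp add: O'_def)
  then have O'sub: "O' \<subseteq> B0" "\<And>x i. x \<in> O' \<Longrightarrow> i \<in> J \<Longrightarrow> f i x \<in> V" and
    nz: "\<And>x i. x \<in> O' \<Longrightarrow> i \<in> I - J \<Longrightarrow> x i \<noteq> 0"
    unfolding O1_def by blast+
  have O'J: "i \<in> J" if "x \<in> O'" "i \<in> I" "x i = 0" for x i
    using nz[OF that(1), of i] that(2,3) by blast
  have O'eucl: "O' \<subseteq> eucl N" by (rule open_eucl_subset[OF O'])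
  have stable: "x(i := 0) \<in> O'" if "x \<in> O'" "i \<in> J" for x i
    using that \<delta>(1) unfolding O'_def cube_def J_def by auto
  have "\<exists>G. smooth_fun N O' G \<and> (\<forall>i\<in>J. \<forall>x\<in>O'. x i = 0 \<longrightarrow> G x = \<phi> (f i x) j)" if j: "j < d" for j
  proof -
    have sm: "smooth_fun N O' (\<lambda>x. \<phi> (f i x) j)" if i: "i \<in> J" for i
    proof (rule smooth_fun_subset[OF smooth_into_chart[OF f_smooth chart(1) j] O'])
      show "i \<in> I" using i J_def by simp
      show "O' \<subseteq> {u \<in> eucl N. f i u \<in> V}" using O'sub(2)[OF _ i] O'eucl by blast
    qed
    have co: "\<phi> (f i x) j = \<phi> (f i' x) j" if "i \<in> J" "i' \<in> J" "x \<in> O'" "x i = 0" "x i' = 0" for i i' x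
      using f_compatible[of i i' x] that O'eucl unfolding J_def by auto
    obtain H where "smooth_fun N O' H" "\<And>i x. i \<in> J \<Longrightarrow> x \<in> O' \<Longrightarrow> x i = 0 \<Longrightarrow> H x = \<phi> (f i x) j"
      by (rule smooth_extension_from_hyperplanes[OF finJ O' stable sm co]) (assumption | rule that)+
    then show ?thesis by blast
  qed
  then obtain G0 where G0: "\<And>j. j < d \<Longrightarrow> smooth_fun N O' (G0 j)"
    "\<And>i j x. j < d \<Longrightarrow> i \<in> J \<Longrightarrow> x \<in> O' \<Longrightarrow> x i = 0 \<Longrightarrow> G0 j x = \<phi> (f i x) j"
    by metis
  define G where "G x = (\<lambda>j. if j < d then G0 j x else 0)" for x
  have Gsm: "smooth_fun N O' (\<lambda>x. G x j)" if "j < d" for j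
    using G0(1)[OF that] that by (simp add: G_def)
  have GH: "G x = \<phi> (f i x)" if "i \<in> J" "x \<in> O'" "x i = 0" for i x
  proof
    fix j
    have "\<phi> (f i x) \<in> eucl d" by (rule chart_in_eucl[OF chart(1) O'sub(2)[OF that(2,1)]])
    then show "G x j = \<phi> (f i x) j" using G0(2)[OF _ that] by (auto simp: G_def)
  qed
  have Geucl: "G ` O' \<subseteq> eucl d" by (auto simp: G_def)
  define B where "B = {x \<in> O'. G x \<in> Q}"
  show thesis
  proof
    show "(V, \<phi>) \<in> \<A>" by fact
    show Q: "open_eucl d Q" unfolding Q_def by (rule open_eucl_cube)
    show "Q \<subseteq> \<phi> ` V" using e Q_def by simp
    show "(\<lambda>j. y j + t * (z j - y j)) \<in> Q" if yz: "y \<in> Q" "z \<in> Q" and t: "0 \<le> t" "t \<le> 1" for y z t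
    proof -
      have "\<bar>y j + t * (z j - y j) - \<phi> m j\<bar> < e" if j: "j < d" for j
      proof -
        have yz': "\<bar>y j - \<phi> m j\<bar> < e" "\<bar>z j - \<phi> m j\<bar> < e"
          using yz j by (auto simp: Q_def cube_def)
        have "y j + t * (z j - y j) - \<phi> m j = (1 - t) * (y j - \<phi> m j) + t * (z j - \<phi> m j)"
          by (simp add: algebra_simps)
        moreover have "(1 - t) * (y j - \<phi> m j) + t * (z j - \<phi> m j) < e"
          by (rule convex_bound_lt) (use yz' t in auto)
        moreover have "(1 - t) * (\<phi> m j - y j) + t * (\<phi> m j - z j) < e"
          by (rule convex_bound_lt) (use yz' t in auto)
        ultimately show ?thesis by (simp add: algebra_simps abs_less_iff)
      qed
      then show ?thesis using yz by (auto simp: Q_def cube_def)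
    qed
    show B: "open_eucl N B"
      unfolding B_def by (rule open_eucl_preimage_eucl[OF O' Geucl Gsm Q])
    have "p \<in> O'" unfolding O'_def using pE \<delta>(1) by (rule centre_in_cube)
    moreover have "G p = \<phi> m" using GH[OF i0 \<open>p \<in> O'\<close>] i0 m_def J_def by simp
    ultimately show "p \<in> B" using centre_in_cube[OF phim e(1)] by (simp add: B_def Q_def)
    show "B \<subseteq> B0" using O'sub(1) B_def by blast
    show "G ` B \<subseteq> Q" unfolding B_def by blast
    show "smooth_fun N B (\<lambda>x. G x j)" if "j < d" for j
      by (rule smooth_fun_subset[OF Gsm[OF that] B]) (auto simp: B_def)
    show "f i x \<in> V \<and> G x = \<phi> (f i x)" if "i \<in> I" "x \<in> B" "x i = 0" for i x
      using O'sub(2)[of x i] O'J[of x i] GH[of i x] that unfolding B_def by blast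
  qed
qed

lemma extends_over_nbhd:
  assumes p: "p \<in> hyper" and B0: "open_eucl N B0" "p \<in> B0"
  shows "\<exists>K. open_eucl N K \<and> p \<in> K \<and> extends_over B0 K"
proof -
  obtain V \<phi> Q G B where chart: "(V, \<phi>) \<in> \<A>" and Q: "open_eucl d Q" "Q \<subseteq> \<phi> ` V"
    and conv: "\<And>y z t. y \<in> Q \<Longrightarrow> z \<in> Q \<Longrightarrow> 0 \<le> t \<Longrightarrow> t \<le> 1 \<Longrightarrow> (\<lambda>j. y j + t * (z j - y j)) \<in> Q"
    and B: "open_eucl N B" "p \<in> B" "B \<subseteq> B0"
    and G: "G ` B \<subseteq> Q" "\<And>j. j < d \<Longrightarrow> smooth_fun N B (\<lambda>x. G x j)"
      "\<And>i x. i \<in> I \<Longrightarrow> x \<in> B \<Longrightarrow> x i = 0 \<Longrightarrow> f i x \<in> V \<and> G x = \<phi> (f i x)"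
    by (rule local_chart_extension[OF p B0]) (rule that; assumption)
  obtain \<rho> B' S where \<rho>: "smooth_fun N (eucl N) \<rho>" "\<And>x. 0 \<le> \<rho> x" "\<And>x. \<rho> x \<le> 1"
    and B': "open_eucl N B'" "p \<in> B'" "B' \<subseteq> S" and S: "S \<subseteq> B" "open_eucl N (eucl N - S)"
    and \<rho>1: "\<And>x. x \<in> B' \<Longrightarrow> \<rho> x = 1" and \<rho>0: "\<And>x. x \<in> eucl N - S \<Longrightarrow> \<rho> x = 0"
    by (rule smooth_bump[OF B(1,2)]) (rule that; assumption)
  define \<psi> where "\<psi> = inv_into V \<phi>"
  have \<psi>: "\<psi> (\<phi> y) = y" if "y \<in> V" for y
    unfolding \<psi>_def using that chart_inj[OF chart] by simp
  have "\<exists>U' F'. partial_ext U' F' \<and> U \<inter> hyper \<subseteq> U' \<and> B' \<inter> hyper \<subseteq> U' \<and>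
        (\<forall>x\<in>eucl N - B0. (x \<in> U' \<longleftrightarrow> x \<in> U) \<and> F' x = F x)" if UF: "partial_ext U F" for U F
  proof -
    have F: "smooth_into N U F" "\<And>i x. i \<in> I \<Longrightarrow> x \<in> U \<Longrightarrow> x i = 0 \<Longrightarrow> F x = f i x"
      using UF unfolding partial_ext_def by blast+
    have U: "open_eucl N U" "U \<subseteq> eucl N"
      using F(1) smooth_into_open open_eucl_subset by blast+
    define W where "W = {x \<in> U. F x \<in> V}"
    have W: "open_eucl N W"
      unfolding W_def by (rule smooth_into_preimage[OF F(1) chart_domain[OF chart]])
    have Wsm: "smooth_fun N W (\<lambda>x. \<phi> (F x) j)" if "j < d" for j
      unfolding W_def by (rule smooth_into_chart[OF F(1) chart that])
    \<comment> \<open>On \<open>T\<close> both extensions have coordinates in \<open>Q\<close>, so that they can be blended.\<close>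
    define T where "T = {x \<in> W. \<phi> (F x) \<in> Q} \<inter> B"
    have T: "open_eucl N T"
      unfolding T_def
    proof (intro openin_Int B(1) open_eucl_preimage_eucl[OF W _ Wsm Q(1)])
      show "(\<lambda>x. \<phi> (F x)) ` W \<subseteq> eucl d" using chart_in_eucl[OF chart] unfolding W_def by blast
    qed
    have TU: "T \<subseteq> U" "T \<subseteq> W" "T \<subseteq> B" unfolding T_def W_def by blast+
    define mix where "mix x = (\<lambda>j. \<phi> (F x) j + \<rho> x * (G x j - \<phi> (F x) j))" for x
    define F' where "F' x = (if x \<in> B' then \<psi> (G x) else if x \<in> T then \<psi> (mix x) else F x)" for x
    \<comment> \<open>The three definitions agree on overlaps: \<open>\<rho> = 1\<close> on \<open>B'\<close>, and \<open>\<rho> = 0\<close> off \<open>S\<close>. The points of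
      \<open>U \<inter> S\<close> outside \<open>T \<union> B'\<close> are given up; none of them lies on a hyperplane.\<close>
    define U' where "U' = (U - S) \<union> T \<union> B'"
    have mixQ: "mix x \<in> Q" if "x \<in> T" for x
      unfolding mix_def by (rule conv) (use that G(1) \<rho>(2,3) in \<open>auto simp: T_def\<close>)
    have mix1: "mix x = G x" if "x \<in> B'" for x
      using \<rho>1[OF that] by (simp add: mix_def)
    have mix0: "\<psi> (mix x) = F x" if "x \<in> T" "x \<notin> S" for x
    proof -
      have "\<rho> x = 0" using \<rho>0 that TU U(2) by blast
      then show ?thesis using \<psi>[of "F x"] that TU(2) by (auto simp: mix_def W_def)
    qed
    have smB': "smooth_into N B' F'"
    proof (rule smooth_into_cong)
      show "smooth_into N B' (\<lambda>x. \<psi> (G x))"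
        unfolding \<psi>_def
      proof (rule smooth_into_from_chart[OF chart B'(1)])
        show "G ` B' \<subseteq> \<phi> ` V" using G(1) Q(2) B'(3) S(1) by blast
        show "smooth_fun N B' (\<lambda>x. G x j)" if "j < d" for j
          by (rule smooth_fun_subset[OF G(2)[OF that] B'(1)]) (use B'(3) S(1) in blast)
      qed
    qed (simp add: F'_def)
    have smT: "smooth_into N T F'"
    proof (rule smooth_into_cong)
      show "smooth_into N T (\<lambda>x. \<psi> (mix x))"
        unfolding \<psi>_def
      proof (rule smooth_into_from_chart[OF chart T])
        show "mix ` T \<subseteq> \<phi> ` V" using mixQ Q(2) by blast
        show "smooth_fun N T (\<lambda>x. mix x j)" if "j < d" for j
          unfolding mix_def using smooth_fun_subset[OF G(2)[OF that] T TU(3)]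
            smooth_fun_subset[OF Wsm[OF that] T TU(2)]
            smooth_fun_subset[OF \<rho>(1) T open_eucl_subset[OF T]]
          by (intro smooth_fun_add smooth_fun_mult smooth_fun_diff)
      qed
    qed (simp add: F'_def mix1)
    have US: "open_eucl N (U - S)"
    proof -
      have "U - S = U \<inter> (eucl N - S)" using U(2) by blast
      then show ?thesis using U(1) S(2) by (simp add: openin_Int)
    qed
    have F'F: "F' x = F x" if "x \<in> U - S" for x
      using that B'(3) mix0[of x] unfolding F'_def by auto
    have smU: "smooth_into N (U - S) F'"
      by (rule smooth_into_cong[OF smooth_into_subset[OF F(1) US]]) (use F'F in auto)
    have "smooth_into N U' F'"
    proof (rule smooth_into_local)
      fix u assume "u \<in> U'"
      then consider "u \<in> U - S" | "u \<in> T" | "u \<in> B'" unfolding U'_def by blast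
      then show "\<exists>W. u \<in> W \<and> W \<subseteq> U' \<and> smooth_into N W F'"
      proof cases
        case 1
        then show ?thesis using smU by (intro exI[of _ "U - S"]) (auto simp: U'_def)
      next
        case 2
        then show ?thesis using smT by (intro exI[of _ T]) (auto simp: U'_def)
      next
        case 3
        then show ?thesis using smB' by (intro exI[of _ B']) (auto simp: U'_def)
      qed
    qed
    moreover have "F' x = f i x" if i: "i \<in> I" and x: "x \<in> U'" "x i = 0" for i x
    proof -
      have GB: "\<psi> (G x) = f i x" if "x \<in> B" using G(3)[of i x, OF i that x(2)] \<psi> by simp
      consider "x \<in> B'" | "x \<notin> B'" "x \<in> T" | "x \<notin> B'" "x \<notin> T" "x \<in> U" using x(1) unfolding U'_def by blast
      then show ?thesis
      proof cases
        case 1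
        then show ?thesis using GB B'(3) S(1) by (auto simp: F'_def)
      next
        case 2
        have "F x = f i x" using F(2)[of i x, OF i _ x(2)] 2 TU by blast
        moreover have "G x = \<phi> (f i x)" using G(3)[of i x, OF i _ x(2)] 2 TU by blast
        ultimately have "mix x = G x" by (simp add: mix_def)
        then show ?thesis using 2 GB TU(3) by (auto simp: F'_def)
      next
        case 3
        then show ?thesis using F(2)[of i x, OF i _ x(2)] by (simp add: F'_def)
      qed
    qed
    ultimately have "partial_ext U' F'" unfolding partial_ext_def by blast
    moreover have "U \<inter> hyper \<subseteq> U'"
    proof
      fix x assume x: "x \<in> U \<inter> hyper"
      then obtain i where i: "i \<in> I" "x i = 0" unfolding hyper_def by blast
      show "x \<in> U'"
      proof (cases "x \<in> S")
        case True
        then have xB: "x \<in> B" using S(1) by blast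
        have "F x = f i x" using F(2) i x by blast
        then have "F x \<in> V" "\<phi> (F x) \<in> Q" using G(3)[OF i(1) xB i(2)] G(1) xB by auto
        then show ?thesis using x xB unfolding U'_def T_def W_def by blast
      qed (use x U'_def in blast)
    qed
    moreover have "B' \<inter> hyper \<subseteq> U'" unfolding U'_def by blast
    moreover have "(x \<in> U' \<longleftrightarrow> x \<in> U) \<and> F' x = F x" if x: "x \<in> eucl N - B0" for x
    proof -
      have "x \<notin> S" "x \<notin> B'" "x \<notin> T" using x B(3) S(1) B'(3) TU(3) by blast+
      then show ?thesis unfolding U'_def F'_def by simp
    qed
    ultimately show ?thesis by blast
  qed
  then have "extends_over B0 B'" unfolding extends_over_def by blast
  with B'(1,2) show ?thesis by blast
qed

lemma extends_over_Un:
  assumes "extends_over B K1" "extends_over B K2"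
  shows "extends_over B (K1 \<union> K2)"
  unfolding extends_over_def
proof (intro allI impI)
  fix U F assume "partial_ext U F"
  then obtain U1 F1 where 1: "partial_ext U1 F1" "U \<inter> hyper \<subseteq> U1" "K1 \<inter> hyper \<subseteq> U1"
      "\<forall>x\<in>eucl N - B. (x \<in> U1 \<longleftrightarrow> x \<in> U) \<and> F1 x = F x"
    using assms(1) unfolding extends_over_def by blast
  then obtain U2 F2 where 2: "partial_ext U2 F2" "U1 \<inter> hyper \<subseteq> U2" "K2 \<inter> hyper \<subseteq> U2"
      "\<forall>x\<in>eucl N - B. (x \<in> U2 \<longleftrightarrow> x \<in> U1) \<and> F2 x = F1 x"
    using assms(2) unfolding extends_over_def by blast
  have "U \<inter> hyper \<subseteq> U2" "(K1 \<union> K2) \<inter> hyper \<subseteq> U2" using 1(2,3) 2(2,3) by blast+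
  moreover have "\<forall>x\<in>eucl N - B. (x \<in> U2 \<longleftrightarrow> x \<in> U) \<and> F2 x = F x" using 1(4) 2(4) by simp
  ultimately show "\<exists>U' F'. partial_ext U' F' \<and> U \<inter> hyper \<subseteq> U' \<and> (K1 \<union> K2) \<inter> hyper \<subseteq> U' \<and>
        (\<forall>x\<in>eucl N - B. (x \<in> U' \<longleftrightarrow> x \<in> U) \<and> F' x = F x)"
    using 2(1) by blast
qed

lemma extends_over_compact:
  assumes K: "compactin (Euclidean_space N) K" "K \<subseteq> hyper" "K \<subseteq> B" and B: "open_eucl N B"
  shows "extends_over B K"
proof -
  define \<U> where "\<U> = {K'. open_eucl N K' \<and> extends_over B K'}"
  have "K \<subseteq> \<Union>\<U>"
  proof
    fix p assume "p \<in> K"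
    then show "p \<in> \<Union>\<U>" using extends_over_nbhd[OF _ B, of p] K(2,3) unfolding \<U>_def by blast
  qed
  moreover have "\<forall>U\<in>\<U>. open_eucl N U" unfolding \<U>_def by blast
  ultimately obtain \<F> where \<F>: "finite \<F>" "\<F> \<subseteq> \<U>" "K \<subseteq> \<Union>\<F>"
    using K(1) unfolding compactin_def by meson
  have "extends_over B (\<Union>\<F>)"
    using \<F>(1,2)
  proof (induction \<F> rule: finite_induct)
    case empty
    show ?case unfolding extends_over_def by auto
  next
    case (insert K' \<F>)
    then show ?case using extends_over_Un[of B K' "\<Union>\<F>"] unfolding \<U>_def by simp
  qed
  then show ?thesis
    unfolding extends_over_def using \<F>(3) by (meson Int_mono order_refl order_trans)
qed

end

section \<open>Contracting Euclidean space into a neighbourhood of coordinate hyperplanes\<close>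

text \<open>The squared Euclidean norm on the \<open>n\<close>-dimensional space.\<close>

definition sqnorm :: "nat \<Rightarrow> (nat \<Rightarrow> real) \<Rightarrow> real" where
  "sqnorm n x = (\<Sum>j<n. (x j)\<^sup>2)"

lemma smooth_fun_sqnorm: "open_eucl n U \<Longrightarrow> smooth_fun n U (sqnorm n)"
  unfolding sqnorm_def by (intro smooth_fun_sum smooth_fun_power smooth_fun_coord)

lemma sqnorm_nonneg: "0 \<le> sqnorm n x"
  unfolding sqnorm_def by (intro sum_nonneg) simp

lemma coord_le_sqnorm: "j < n \<Longrightarrow> (x j)\<^sup>2 \<le> sqnorm n x"
  unfolding sqnorm_def by (intro member_le_sum) auto

lemma sqnorm_scale: "sqnorm n (\<lambda>j. x j * s) = s\<^sup>2 * sqnorm n x"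
  unfolding sqnorm_def by (simp add: power_mult_distrib sum_distrib_left mult.commute)

lemma closed_eucl: "closed (eucl n)"
  using closedin_Euclidean_imp_closed[OF closedin_topspace[of "Euclidean_space n"]]
  unfolding topspace_Euclidean_space .

lemma compactin_sqnorm_ball:
  assumes "closed C"
  shows "compactin (Euclidean_space n) {x \<in> eucl n. sqnorm n x \<le> R \<and> x \<in> C}"
proof -
  define K where "K = (\<Pi>\<^sub>E i\<in>(UNIV::nat set). {- sqrt R..sqrt R})"
  have "compactin (product_topology (\<lambda>i. euclidean) UNIV) K"
    unfolding K_def by (subst compactin_PiE) (auto simp: compactin_euclidean_iff)
  then have K: "compact K"
    by (simp add: euclidean_product_topology compactin_euclidean_iff)
  have "continuous_on UNIV (sqnorm n)"
    unfolding sqnorm_def by (intro continuous_intros continuous_on_product_coordinates)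
  then have "closed {x. sqnorm n x \<le> R}"
    by (intro closed_Collect_le continuous_on_const)
  then have cl: "closed (eucl n \<inter> {x. sqnorm n x \<le> R} \<inter> C)"
    using assms closed_eucl by (intro closed_Int)
  have eq: "{x \<in> eucl n. sqnorm n x \<le> R \<and> x \<in> C} = K \<inter> (eucl n \<inter> {x. sqnorm n x \<le> R} \<inter> C)"
  proof -
    have "x \<in> K" if x: "x \<in> eucl n" "sqnorm n x \<le> R" for x
    proof -
      have "x i \<in> {- sqrt R..sqrt R}" for i
      proof (cases "i < n")
        case True
        then have "(x i)\<^sup>2 \<le> R" using coord_le_sqnorm[of i n x] x(2) by simp
        then have "\<bar>x i\<bar> \<le> sqrt R" using real_le_rsqrt[of "\<bar>x i\<bar>" R] by simp
        then show ?thesis by auto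
      next
        case False
        then show ?thesis using x sqnorm_nonneg[of n x] by simp
      qed
      then show ?thesis unfolding K_def by auto
    qed
    then show ?thesis by auto
  qed
  have "compact {x \<in> eucl n. sqnorm n x \<le> R \<and> x \<in> C}"
    unfolding eq by (rule compact_Int_closed[OF K cl])
  then show ?thesis
    unfolding Euclidean_space_eq by (auto simp: compactin_subtopology compactin_euclidean_iff)
qed

text \<open>
  Let \<open>P\<close> be the product of the coordinates in \<open>I\<close>. Scaling by \<open>s = 1 / (1 + c * (P x)\<^sup>2)\<close> moves every
  point of a fixed ball into \<open>U\<close>, provided that \<open>c\<close> is large. Indeed, by compactness \<open>P\<^sup>2\<close> is bounded
  below by some \<open>m > 0\<close> on the points of the ball outside \<open>U\<close>. If \<open>y = s x\<close> is outside \<open>U\<close>, then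
  \<open>m \<le> (P y)\<^sup>2 \<le> (P x)\<^sup>2\<close>, so \<open>s\<close> is small and \<open>y\<close> lies in a given neighbourhood of the origin, which
  is contained in \<open>U\<close>, a contradiction.
\<close>

lemma contraction_factor:
  fixes U :: "(nat \<Rightarrow> real) set" and R :: real
  assumes I: "finite I" "I \<noteq> {}" and U: "open_eucl n U" "{x \<in> eucl n. \<exists>i\<in>I. x i = 0} \<subseteq> U"
  shows "\<exists>A\<ge>0. \<forall>x\<in>eucl n. \<forall>c\<ge>A. sqnorm n x \<le> R \<longrightarrow> (\<lambda>j. x j * inverse (1 + c * (\<Prod>i\<in>I. x i)\<^sup>2)) \<in> U"
proof -
  define P :: "(nat \<Rightarrow> real) \<Rightarrow> real" where "P x = (\<Prod>i\<in>I. x i)" for x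
  have "(\<lambda>j. 0) \<in> U" using U(2) I(2) by auto
  then obtain e where e: "e > 0" "cube n (\<lambda>j. 0) e \<subseteq> U" using U(1) open_eucl_cubeE by metis
  have small: "y \<in> U" if y: "y \<in> eucl n" "sqnorm n y < e\<^sup>2" for y
  proof -
    have "\<bar>y j\<bar> < e" if "j < n" for j
    proof -
      have "(y j)\<^sup>2 < e\<^sup>2" using coord_le_sqnorm[OF that, of y] y(2) by simp
      then show ?thesis using e(1) power_less_imp_less_base[of "\<bar>y j\<bar>" 2 e] by simp
    qed
    then show ?thesis using y(1) e(2) by (auto simp: cube_def)
  qed
  obtain T where T: "open T" "U = eucl n \<inter> T"
    using U(1) unfolding Euclidean_space_eq openin_open by blast
  define Z where "Z = {x \<in> eucl n. sqnorm n x \<le> R \<and> x \<in> - T}"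
  have Z: "compact Z"
    using compactin_sqnorm_ball[of "- T" n R] T(1)
    unfolding Z_def Euclidean_space_eq by (auto simp: compactin_subtopology compactin_euclidean_iff)
  have contP: "continuous_on Z (\<lambda>x. (P x)\<^sup>2)"
    unfolding P_def by (intro continuous_intros continuous_on_subset[OF continuous_on_product_coordinates]) auto
  have "\<exists>m>0. \<forall>y\<in>Z. m \<le> (P y)\<^sup>2"
  proof (cases "Z = {}")
    case False
    obtain z where z: "z \<in> Z" "\<And>y. y \<in> Z \<Longrightarrow> (P z)\<^sup>2 \<le> (P y)\<^sup>2"
      using continuous_attains_inf[OF Z False contP] by blast
    have "z \<in> eucl n" "z \<notin> U" using z(1) T(2) unfolding Z_def by blast+
    then have "\<forall>i\<in>I. z i \<noteq> 0" using U(2) by blast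
    then have "(P z)\<^sup>2 > 0" unfolding P_def using I(1) by simp
    then show ?thesis using z(2) by blast
  qed (auto intro: exI[of _ 1])
  then obtain m where m: "m > 0" "\<And>y. y \<in> Z \<Longrightarrow> m \<le> (P y)\<^sup>2" by blast
  define A where "A = (\<bar>R\<bar> / e\<^sup>2 + 1) / m"
  have A0: "A \<ge> 0" unfolding A_def using m(1) by simp
  have "(\<lambda>j. x j * inverse (1 + c * (P x)\<^sup>2)) \<in> U"
    if x: "x \<in> eucl n" and c: "c \<ge> A" and q: "sqnorm n x \<le> R" for x c
  proof (rule ccontr)
    define s where "s = inverse (1 + c * (P x)\<^sup>2)"
    define y where "y = (\<lambda>j. x j * s)"
    assume "\<not> ?thesis"
    then have yU: "y \<notin> U" by (simp add: y_def s_def)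
    have c0: "c \<ge> 0" using A0 c by simp
    have pos: "1 \<le> 1 + c * (P x)\<^sup>2" using c0 by simp
    then have s: "0 < s" "s \<le> 1" unfolding s_def by (auto intro: inverse_le_1_iff[THEN iffD2])
    have yE: "y \<in> eucl n" using x by (simp add: y_def)
    have qy: "sqnorm n y = s\<^sup>2 * sqnorm n x" unfolding y_def by (rule sqnorm_scale)
    have s21: "s\<^sup>2 \<le> 1" using s by (simp add: power_le_one)
    have "sqnorm n y \<le> R"
      using qy mult_right_mono[OF s21 sqnorm_nonneg[of n x]] q by simp
    then have "y \<in> Z" using yE yU T(2) unfolding Z_def by blast
    then have "m \<le> (P y)\<^sup>2" by (rule m(2))
    also have "(P y)\<^sup>2 = (s\<^sup>2) ^ card I * (P x)\<^sup>2"
      unfolding P_def y_def by (simp add: prod.distrib power_mult_distrib mult.commute flip: power_mult)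
    also have "\<dots> \<le> 1 * (P x)\<^sup>2"
      by (intro mult_right_mono power_le_one[OF _ s21]) simp_all
    finally have mP: "m \<le> (P x)\<^sup>2" by simp
    have "\<bar>R\<bar> / e\<^sup>2 + 1 = A * m" using m(1) by (simp add: A_def)
    also have "\<dots> \<le> c * (P x)\<^sup>2" using c mP m(1) c0 by (intro mult_mono) auto
    finally have big: "\<bar>R\<bar> / e\<^sup>2 < 1 + c * (P x)\<^sup>2" by simp
    also have "\<dots> \<le> (1 + c * (P x)\<^sup>2)\<^sup>2"
      using mult_left_mono[OF pos, of "1 + c * (P x)\<^sup>2"] pos by (simp add: power2_eq_square)
    finally have "\<bar>R\<bar> < e\<^sup>2 * (1 + c * (P x)\<^sup>2)\<^sup>2" using e(1) by (simp add: divide_simps mult.commute)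
    then have "s\<^sup>2 * \<bar>R\<bar> < s\<^sup>2 * (e\<^sup>2 * (1 + c * (P x)\<^sup>2)\<^sup>2)"
      using s(1) by (intro mult_strict_left_mono) auto
    also have "\<dots> = e\<^sup>2 * (s * (1 + c * (P x)\<^sup>2))\<^sup>2" by (simp only: power_mult_distrib mult_ac)
    also have "s * (1 + c * (P x)\<^sup>2) = 1" unfolding s_def using pos by simp
    finally have "s\<^sup>2 * \<bar>R\<bar> < e\<^sup>2" by simp
    moreover have "s\<^sup>2 * sqnorm n x \<le> s\<^sup>2 * \<bar>R\<bar>" using q by (intro mult_left_mono) auto
    ultimately have "sqnorm n y < e\<^sup>2" using qy by simp
    then show False using small[OF yE] yU by blast
  qed
  with A0 show ?thesis unfolding P_def by blast
qed

text \<open>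
  Given a bound \<open>A k\<close> for the ball of squared radius \<open>k\<close>, for each \<open>k\<close>, there is a smooth function
  that satisfies at every point the bound for some ball containing that point. It is a constant plus
  a locally finite sum of multiples of flat functions of \<open>sqnorm n x - k\<close>: only those with
  \<open>k < sqnorm n x\<close> contribute.
\<close>

lemma smooth_majorant:
  fixes A :: "nat \<Rightarrow> real"
  assumes A: "\<And>k. A k \<ge> 0"
  obtains C where "smooth_fun n (eucl n) C"
    "\<And>x. x \<in> eucl n \<Longrightarrow> \<exists>k. sqnorm n x \<le> real k \<and> A k \<le> C x"
proof -
  define weight where "weight k x = exp 1 * A (k + 2) * flat 0 (sqnorm n x - real k)" for k x
  have weight0: "weight k x \<ge> 0" for k x unfolding weight_def using A flat_nonneg by simp
  define C where "C x = A 1 + (\<Sum>k<nat \<lceil>sqnorm n x\<rceil>. weight k x)" for x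
  have C_eq: "C x = A 1 + (\<Sum>k<K. weight k x)" if "sqnorm n x \<le> real K" for x K
  proof -
    have "nat \<lceil>sqnorm n x\<rceil> \<le> K" using that by linarith
    moreover have "weight k x = 0" if "k \<in> {..<K} - {..<nat \<lceil>sqnorm n x\<rceil>}" for k
    proof -
      have "sqnorm n x \<le> real k" using that by (simp add: nat_le_iff ceiling_le_iff not_less)
      then show ?thesis unfolding weight_def by (simp add: flat_0)
    qed
    ultimately show ?thesis unfolding C_def
      by (simp add: sum.mono_neutral_left[of "{..<K}" "{..<nat \<lceil>sqnorm n x\<rceil>}" "\<lambda>k. weight k x"])
  qed
  show thesis
  proof
    show "smooth_fun n (eucl n) C"
    proof (rule smooth_fun_local)
      fix x0 :: "nat \<Rightarrow> real" assume x0: "x0 \<in> eucl n"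
      define K where "K = nat \<lceil>sqnorm n x0\<rceil> + 1"
      define W where "W = {x \<in> eucl n. sqnorm n x \<in> {..<real K}}"
      have W: "open_eucl n W"
        unfolding W_def by (rule open_eucl_preimage[OF smooth_fun_sqnorm]) auto
      have "sqnorm n x0 < real K" unfolding K_def by linarith
      then have "x0 \<in> W" using x0 by (simp add: W_def)
      moreover have "smooth_fun n W C"
      proof (rule smooth_fun_cong)
        show "smooth_fun n W (\<lambda>x. A 1 + (\<Sum>k<K. weight k x))"
          unfolding weight_def
          by (intro smooth_fun_add smooth_fun_sum smooth_fun_mult smooth_fun_flat smooth_fun_diff
              smooth_fun_const smooth_fun_sqnorm W)
        show "A 1 + (\<Sum>k<K. weight k x) = C x" if "x \<in> W" for x
          using C_eq[of x K] that by (simp add: W_def)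
      qed
      moreover have "W \<subseteq> eucl n" by (auto simp: W_def)
      ultimately show "\<exists>V. x0 \<in> V \<and> V \<subseteq> eucl n \<and> smooth_fun n V C" by blast
    qed
    fix x :: "nat \<Rightarrow> real" assume "x \<in> eucl n"
    show "\<exists>k. sqnorm n x \<le> real k \<and> A k \<le> C x"
    proof (cases "sqnorm n x \<le> 1")
      case True
      have "A 1 \<le> C x" unfolding C_def using weight0 by (simp add: sum_nonneg)
      then show ?thesis using True by (intro exI[of _ 1]) simp
    next
      case False
      define k where "k = nat \<lfloor>sqnorm n x\<rfloor> - 1"
      have k: "real k + 1 \<le> sqnorm n x" "sqnorm n x \<le> real k + 2"
        using False unfolding k_def by linarith+
      have "k < nat \<lceil>sqnorm n x\<rceil>" using k(1) by linarith
      then have "weight k x \<le> (\<Sum>k<nat \<lceil>sqnorm n x\<rceil>. weight k x)"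
        by (intro member_le_sum) (auto simp: weight0)
      then have 1: "weight k x \<le> C x" unfolding C_def using A[of 1] by simp
      have "exp (-1) \<le> flat 0 (sqnorm n x - real k)"
        using k(1) by (auto simp: flat_def intro: inverse_le_1_iff[THEN iffD2])
      then have "exp 1 * A (k + 2) * exp (- 1) \<le> weight k x"
        unfolding weight_def using A by (intro mult_left_mono) auto
      moreover have "exp 1 * A (k + 2) * exp (- 1) = A (k + 2)"
        by (simp add: exp_minus)
      ultimately have "A (k + 2) \<le> C x" using 1 by linarith
      then show ?thesis using k(2) by (intro exI[of _ "k + 2"] conjI) simp_all
    qed
  qed
qed

lemma contraction_into_hyperplane_nbhd:
  assumes I: "finite I" "I \<noteq> {}" and U: "open_eucl n U" "{x \<in> eucl n. \<exists>i\<in>I. x i = 0} \<subseteq> U"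
  obtains r where "\<And>j. smooth_fun n (eucl n) (\<lambda>x. r x j)" "r ` eucl n \<subseteq> U"
    "\<And>i x. i \<in> I \<Longrightarrow> x i = 0 \<Longrightarrow> r x = x"
proof -
  have "\<exists>A. \<forall>k. A k \<ge> 0 \<and> (\<forall>x\<in>eucl n. \<forall>c\<ge>A k. sqnorm n x \<le> real k \<longrightarrow>
      (\<lambda>j. x j * inverse (1 + c * (\<Prod>i\<in>I. x i)\<^sup>2)) \<in> U)"
    using contraction_factor[OF I U] by (intro choice) meson
  then obtain A where A: "\<And>k. A k \<ge> 0"
    "\<And>k x c. x \<in> eucl n \<Longrightarrow> c \<ge> A k \<Longrightarrow> sqnorm n x \<le> real k \<Longrightarrow>
      (\<lambda>j. x j * inverse (1 + c * (\<Prod>i\<in>I. x i)\<^sup>2)) \<in> U"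
    by blast
  obtain C where C: "smooth_fun n (eucl n) C" "\<And>x. x \<in> eucl n \<Longrightarrow> \<exists>k. sqnorm n x \<le> real k \<and> A k \<le> C x"
    by (rule smooth_majorant[of A n, OF A(1)]) (rule that; assumption)
  define r where "r x = (\<lambda>j. x j * inverse (1 + C x * (\<Prod>i\<in>I. x i)\<^sup>2))" for x
  show thesis
  proof
    fix j
    have "1 + C x * (\<Prod>i\<in>I. x i)\<^sup>2 \<noteq> 0" if x: "x \<in> eucl n" for x
    proof -
      obtain k where "A k \<le> C x" using C(2)[OF x] by blast
      then have "C x \<ge> 0" using A(1)[of k] by simp
      then have "C x * (\<Prod>i\<in>I. x i)\<^sup>2 \<ge> 0" by simp
      then show ?thesis by linarith
    qed
    then have "smooth_fun n (eucl n) (\<lambda>x. x j / (1 + C x * (\<Prod>i\<in>I. x i)\<^sup>2))"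
      by (intro smooth_fun_divide smooth_fun_add smooth_fun_mult smooth_fun_power smooth_fun_prod
          smooth_fun_coord smooth_fun_const C(1) open_eucl_eucl)
    then show "smooth_fun n (eucl n) (\<lambda>x. r x j)" by (simp add: r_def divide_inverse)
  next
    show "r ` eucl n \<subseteq> U"
    proof
      fix y assume "y \<in> r ` eucl n"
      then obtain x where x: "x \<in> eucl n" "y = r x" by blast
      obtain k where "sqnorm n x \<le> real k" "A k \<le> C x" using C(2)[OF x(1)] by blast
      then show "y \<in> U" unfolding x(2) r_def by (intro A(2)[OF x(1)])
    qed
  next
    fix i and x :: "nat \<Rightarrow> real" assume "i \<in> I" "x i = 0"
    then have "(\<Prod>i\<in>I. x i) = 0" using I(1) by (auto intro: prod_zero)
    then show "r x = x" by (simp add: r_def)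
  qed
qed

section \<open>Extension of maps from coordinate hyperplanes\<close>

context hyperplane_data
begin

lemma closed_hyper: "closed hyper"
proof -
  have "closed {x::nat \<Rightarrow> real. x i = 0}" for i
    by (intro closed_Collect_eq continuous_on_const continuous_on_product_coordinates)
  then have "closed (eucl N \<inter> (\<Union>i\<in>I. {x. x i = 0}))"
    using finite_I closed_eucl by (intro closed_Int closed_UN) auto
  moreover have "hyper = eucl N \<inter> (\<Union>i\<in>I. {x. x i = 0})" unfolding hyper_def by auto
  ultimately show ?thesis by simp
qed

text \<open>
  The step from the open ball of squared radius \<open>k\<close> to that of squared radius \<open>k + 1\<close>. The compact
  shell between them is contained in the open set where the squared norm exceeds \<open>k - 1\<close>, and the
  partial extension changes only there.
\<close>

lemma extend_one_shell:
  assumes "partial_ext U F" "{x \<in> hyper. sqnorm N x < real k} \<subseteq> U"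
  shows "\<exists>U' F'. partial_ext U' F' \<and> {x \<in> hyper. sqnorm N x < real (Suc k)} \<subseteq> U' \<and>
    (\<forall>x\<in>eucl N. sqnorm N x \<le> real k - 1 \<longrightarrow> (x \<in> U' \<longleftrightarrow> x \<in> U) \<and> F' x = F x)"
proof -
  define B where "B = {x \<in> eucl N. sqnorm N x \<in> {real k - 1<..}}"
  define K where "K = {x \<in> eucl N. sqnorm N x \<le> real (Suc k) \<and> x \<in> hyper \<inter> {x. real k \<le> sqnorm N x}}"
  have "continuous_on UNIV (sqnorm N)"
    unfolding sqnorm_def by (intro continuous_intros continuous_on_product_coordinates)
  then have "closed {x. real k \<le> sqnorm N x}"
    by (intro closed_Collect_le continuous_on_const)
  then have "compactin (Euclidean_space N) K"
    unfolding K_def using closed_hyper by (intro compactin_sqnorm_ball closed_Int)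
  moreover have "open_eucl N B"
    unfolding B_def by (rule open_eucl_preimage[OF smooth_fun_sqnorm]) auto
  moreover have "K \<subseteq> hyper" "K \<subseteq> B" unfolding K_def B_def by auto
  ultimately have "extends_over B K" by (intro extends_over_compact)
  then obtain U' F' where UF': "partial_ext U' F'" "U \<inter> hyper \<subseteq> U'" "K \<inter> hyper \<subseteq> U'"
    "\<forall>x\<in>eucl N - B. (x \<in> U' \<longleftrightarrow> x \<in> U) \<and> F' x = F x"
    using assms(1) unfolding extends_over_def by blast
  have "{x \<in> hyper. sqnorm N x < real (Suc k)} \<subseteq> U'"
  proof
    fix x assume x: "x \<in> {x \<in> hyper. sqnorm N x < real (Suc k)}"
    show "x \<in> U'"
    proof (cases "sqnorm N x < real k")
      case True
      then show ?thesis using x assms(2) UF'(2) by blast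
    next
      case False
      then have "x \<in> K" using x unfolding K_def by (auto simp: hyper_def)
      then show ?thesis using x UF'(3) by blast
    qed
  qed
  moreover have "\<forall>x\<in>eucl N. sqnorm N x \<le> real k - 1 \<longrightarrow> (x \<in> U' \<longleftrightarrow> x \<in> U) \<and> F' x = F x"
    using UF'(4) unfolding B_def by auto
  ultimately show ?thesis using UF'(1) by blast
qed

lemma extension_near_hyper: "\<exists>U F. partial_ext U F \<and> hyper \<subseteq> U"
proof -
  have "\<exists>UF. \<forall>k. (partial_ext (fst (UF k)) (snd (UF k)) \<and> {x \<in> hyper. sqnorm N x < real k} \<subseteq> fst (UF k)) \<and>
    (\<forall>x\<in>eucl N. sqnorm N x \<le> real k - 1 \<longrightarrow>
       (x \<in> fst (UF (Suc k)) \<longleftrightarrow> x \<in> fst (UF k)) \<and> snd (UF (Suc k)) x = snd (UF k) x)"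
  proof (rule dependent_nat_choice)
    have "smooth_into N {} (\<lambda>x. undefined)"
      by (rule smooth_into_local) simp
    then show "\<exists>UF. partial_ext (fst UF) (snd UF) \<and> {x \<in> hyper. sqnorm N x < real 0} \<subseteq> fst UF"
      using sqnorm_nonneg[of N] unfolding partial_ext_def
      by (intro exI[of _ "({}, \<lambda>x. undefined)"]) (auto simp: not_less[symmetric])
  next
    fix UF and k :: nat
    assume "partial_ext (fst UF) (snd UF) \<and> {x \<in> hyper. sqnorm N x < real k} \<subseteq> fst UF"
    then obtain U' F' where "partial_ext U' F'" "{x \<in> hyper. sqnorm N x < real (Suc k)} \<subseteq> U'"
      "\<forall>x\<in>eucl N. sqnorm N x \<le> real k - 1 \<longrightarrow> (x \<in> U' \<longleftrightarrow> x \<in> fst UF) \<and> F' x = snd UF x"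
      using extend_one_shell by blast
    then show "\<exists>UF'. (partial_ext (fst UF') (snd UF') \<and> {x \<in> hyper. sqnorm N x < real (Suc k)} \<subseteq> fst UF') \<and>
      (\<forall>x\<in>eucl N. sqnorm N x \<le> real k - 1 \<longrightarrow>
         (x \<in> fst UF' \<longleftrightarrow> x \<in> fst UF) \<and> snd UF' x = snd UF x)"
      by (intro exI[of _ "(U', F')"]) simp
  qed
  then obtain UF where UF: "\<And>k. partial_ext (fst (UF k)) (snd (UF k))"
    "\<And>k. {x \<in> hyper. sqnorm N x < real k} \<subseteq> fst (UF k)"
    "\<And>k x. x \<in> eucl N \<Longrightarrow> sqnorm N x \<le> real k - 1 \<Longrightarrow>
       (x \<in> fst (UF (Suc k)) \<longleftrightarrow> x \<in> fst (UF k)) \<and> snd (UF (Suc k)) x = snd (UF k) x"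
    by blast
  have stable: "(x \<in> fst (UF m) \<longleftrightarrow> x \<in> fst (UF k)) \<and> snd (UF m) x = snd (UF k) x"
    if x: "x \<in> eucl N" "sqnorm N x \<le> real k - 1" and "k \<le> m" for x k m
    using \<open>k \<le> m\<close>
  proof (induction m rule: dec_induct)
    case (step m)
    then have "sqnorm N x \<le> real m - 1" using x(2) by simp
    then show ?case using UF(3)[OF x(1)] step.IH by simp
  qed simp
  \<comment> \<open>From the index \<open>\<kappa> x\<close> on, the sequence of partial extensions is constant at \<open>x\<close>.\<close>
  define \<kappa> where "\<kappa> x = nat \<lceil>sqnorm N x\<rceil> + 1" for x
  have \<kappa>: "sqnorm N x \<le> real (\<kappa> x) - 1" for x unfolding \<kappa>_def by linarith
  define U where "U = {x \<in> eucl N. x \<in> fst (UF (\<kappa> x))}"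
  define F where "F x = snd (UF (\<kappa> x)) x" for x
  have "smooth_into N U F"
  proof (rule smooth_into_local)
    fix x0 assume x0: "x0 \<in> U"
    \<comment> \<open>One more than \<open>\<kappa> x0\<close>, so that the sequence is constant from \<open>k\<close> on near \<open>x0\<close> as well.\<close>
    define k where "k = \<kappa> x0 + 1"
    have k: "smooth_into N (fst (UF k)) (snd (UF k))"
      using UF(1)[of k] unfolding partial_ext_def by blast
    define W where "W = {x \<in> eucl N. sqnorm N x \<in> {..<real k - 1}} \<inter> fst (UF k)"
    have W: "open_eucl N W"
      unfolding W_def using smooth_into_open[OF k]
      by (intro openin_Int open_eucl_preimage[OF smooth_fun_sqnorm]) auto
    have eqk: "(x \<in> fst (UF k) \<longleftrightarrow> x \<in> U) \<and> snd (UF k) x = F x" if x: "x \<in> eucl N" "sqnorm N x < real k - 1" for x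
    proof -
      have "\<lceil>sqnorm N x\<rceil> \<le> int k - 1" using x(2) by linarith
      moreover have "k \<ge> 1" by (simp add: k_def)
      ultimately have "\<kappa> x \<le> k" unfolding \<kappa>_def by linarith
      then show ?thesis using stable[OF x(1) \<kappa>] x(1) unfolding U_def F_def by blast
    qed
    have "smooth_into N W F"
    proof (rule smooth_into_cong[OF smooth_into_subset[OF k W]])
      show "snd (UF k) x = F x" if "x \<in> W" for x using eqk that unfolding W_def by auto
    qed (auto simp: W_def)
    moreover have "x0 \<in> eucl N" using x0 unfolding U_def by blast
    moreover have "sqnorm N x0 < real k - 1" using \<kappa>[of x0] unfolding k_def by simp
    ultimately show "\<exists>W. x0 \<in> W \<and> W \<subseteq> U \<and> smooth_into N W F"
      using eqk x0 by (intro exI[of _ W]) (auto simp: W_def)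
  qed
  moreover have "F x = f i x" if "i \<in> I" "x \<in> U" "x i = 0" for i x
    using UF(1)[of "\<kappa> x"] that unfolding F_def U_def partial_ext_def by blast
  moreover have "hyper \<subseteq> U"
  proof
    fix x assume x: "x \<in> hyper"
    have "sqnorm N x < real (\<kappa> x)" using \<kappa>[of x] by simp
    then show "x \<in> U" using x UF(2)[of "\<kappa> x"] unfolding U_def hyper_def by blast
  qed
  ultimately show ?thesis unfolding partial_ext_def by blast
qed

theorem global_extension:
  assumes "I \<noteq> {}"
  obtains F where "smooth_into N (eucl N) F" "\<And>i x. i \<in> I \<Longrightarrow> x \<in> eucl N \<Longrightarrow> x i = 0 \<Longrightarrow> F x = f i x"
proof -
  obtain U F where UF: "partial_ext U F" "hyper \<subseteq> U" using extension_near_hyper by blast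
  have F: "smooth_into N U F" "\<And>i x. i \<in> I \<Longrightarrow> x \<in> U \<Longrightarrow> x i = 0 \<Longrightarrow> F x = f i x"
    using UF(1) unfolding partial_ext_def by blast+
  obtain r where r: "\<And>j. smooth_fun N (eucl N) (\<lambda>x. r x j)" "r ` eucl N \<subseteq> U"
    "\<And>i x. i \<in> I \<Longrightarrow> x i = 0 \<Longrightarrow> r x = x"
    by (rule contraction_into_hyperplane_nbhd[OF finite_I assms smooth_into_open[OF F(1)]
          UF(2)[unfolded hyper_def]])
      (rule that; assumption)
  show thesis
  proof
    show "smooth_into N (eucl N) (\<lambda>x. F (r x))"
      by (rule smooth_into_compose[OF F(1) open_eucl_eucl r(2,1)])
    show "F (r x) = f i x" if "i \<in> I" "x \<in> eucl N" "x i = 0" for i x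
    proof -
      have "x \<in> U" using that UF(2) unfolding hyper_def by blast
      then show ?thesis using F(2)[of i x, OF that(1) _ that(3)] r(3)[of i x] that by simp
    qed
  qed
qed

end

section \<open>The smooth singular simplicial set\<close>

text \<open>
  The points of the affine simplex, that is, the affine hyperplane of points with coordinate sum one.
\<close>

abbreviation aff :: "nat \<Rightarrow> (nat \<Rightarrow> real) set" where
  "aff n \<equiv> points (affine_simplex n)"

lemma aff_iff: "x \<in> aff n \<longleftrightarrow> x \<in> eucl (Suc n) \<and> (\<Sum>i\<le>n. x i) = 1"
  by (simp add: affine_simplex_def sub_diffeology_def topspace_Euclidean_space)

lemma affine_plots_iff:
  "p \<in> plots (affine_simplex n) m U \<longleftrightarrow>
     open_eucl m U \<and> p \<in> U \<rightarrow>\<^sub>E aff n \<and> (\<forall>j<Suc n. smooth_fun m U (\<lambda>u. p u j))"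
proof -
  have "aff n \<subseteq> eucl (Suc n)" by (auto simp: aff_iff)
  then show ?thesis
    unfolding affine_simplex_def sub_diffeology_def euclidean_diffeology_def
    by (auto simp: smooth_on_iff topspace_Euclidean_space PiE_iff)
qed

lemma smooth_singular_cells: "cells (smooth_singular X) n = smooth_maps (affine_simplex n) X"
  by (simp add: smooth_singular_def)

lemma smooth_singular_act:
  "act (smooth_singular X) m n \<alpha> g = compose (aff m) g (affine_push m \<alpha>)"
  by (simp add: smooth_singular_def)

lemma affine_push_aff:
  assumes \<alpha>: "\<alpha> \<in> {..m} \<rightarrow> {..n}" and x: "x \<in> aff m"
  shows "affine_push m \<alpha> x \<in> aff n"
proof -
  have "(\<Sum>j\<le>n. affine_push m \<alpha> x j) = (\<Sum>j\<le>n. \<Sum>i\<in>{i \<in> {..m}. \<alpha> i = j}. x i)"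
    by (simp add: affine_push_def)
  also have "\<dots> = (\<Sum>i\<le>m. x i)"
    by (rule sum.group) (use \<alpha> in auto)
  finally have "(\<Sum>j\<le>n. affine_push m \<alpha> x j) = 1" using x by (simp add: aff_iff)
  moreover have "affine_push m \<alpha> x j = 0" if "j \<ge> Suc n" for j
  proof -
    have "{i. i \<le> m \<and> \<alpha> i = j} = {}" using \<alpha> that by (fastforce dest: Pi_mem)
    then show ?thesis unfolding affine_push_def by (simp only: sum.empty)
  qed
  ultimately show ?thesis by (simp add: aff_iff)
qed

lemma affine_push_compose:
  assumes "\<alpha> \<in> {..l} \<rightarrow> {..m}"
  shows "affine_push l (compose {..l} \<beta> \<alpha>) x = affine_push m \<beta> (affine_push l \<alpha> x)"
proof
  fix j
  have "affine_push m \<beta> (affine_push l \<alpha> x) j = (\<Sum>k\<in>{k \<in> {..m}. \<beta> k = j}. \<Sum>i\<in>{i \<in> {..l}. \<alpha> i = k}. x i)"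
    by (simp add: affine_push_def)
  also have "\<dots> = (\<Sum>k\<in>{k \<in> {..m}. \<beta> k = j}. \<Sum>i\<in>{i \<in> {i \<in> {..l}. \<beta> (\<alpha> i) = j}. \<alpha> i = k}. x i)"
    by (intro sum.cong) auto
  also have "\<dots> = (\<Sum>i\<in>{i \<in> {..l}. \<beta> (\<alpha> i) = j}. x i)"
    by (rule sum.group) (use assms in auto)
  also have "\<dots> = affine_push l (compose {..l} \<beta> \<alpha>) x j"
    unfolding affine_push_def by (intro sum.cong) (auto simp: compose_def)
  finally show "affine_push l (compose {..l} \<beta> \<alpha>) x j = affine_push m \<beta> (affine_push l \<alpha> x) j" by simp
qed

text \<open>
  An idempotent \<open>\<theta>\<close> of \<open>{0, \<dots>, n}\<close> with image \<open>A\<close> acts as the identity on the face spanned by \<open>A\<close>.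
\<close>

lemma affine_push_retraction:
  assumes A: "A \<subseteq> {..n}" "\<And>i. i \<le> n \<Longrightarrow> \<theta> i \<in> A" "\<And>i. i \<in> A \<Longrightarrow> \<theta> i = i"
    and x: "\<And>i. i \<notin> A \<Longrightarrow> x i = 0"
  shows "affine_push n \<theta> x = x"
proof
  fix j
  show "affine_push n \<theta> x j = x j"
  proof (cases "j \<in> A")
    case True
    have "(\<Sum>i\<in>{i. i \<le> n \<and> \<theta> i = j}. x i) = (\<Sum>i\<in>{j}. x i)"
    proof (rule sum.mono_neutral_right)
      show "\<forall>i\<in>{i. i \<le> n \<and> \<theta> i = j} - {j}. x i = 0"
      proof
        fix i assume "i \<in> {i. i \<le> n \<and> \<theta> i = j} - {j}"
        then have "i \<notin> A" using A(3)[of i] by auto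
        then show "x i = 0" by (rule x)
      qed
    qed (use True A in auto)
    then show ?thesis by (simp add: affine_push_def)
  next
    case False
    then have "{i. i \<le> n \<and> \<theta> i = j} = {}" using A(2) by auto
    then show ?thesis unfolding affine_push_def x[OF False] by (simp only: sum.empty)
  qed
qed

lemma simplex_hom_range: "\<alpha> \<in> simplex_hom m n \<Longrightarrow> \<alpha> \<in> {..m} \<rightarrow> {..n}"
  by (auto simp: simplex_hom_def)

lemma smooth_mapsD:
  "g \<in> smooth_maps Y X \<Longrightarrow> p \<in> plots Y n U \<Longrightarrow> compose U g p \<in> plots X n U"
  by (simp add: smooth_maps_def)

lemma smooth_maps_affine_push:
  assumes \<alpha>: "\<alpha> \<in> {..m} \<rightarrow> {..n}" and g: "g \<in> smooth_maps (affine_simplex n) X"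
  shows "compose (aff m) g (affine_push m \<alpha>) \<in> smooth_maps (affine_simplex m) X"
proof -
  have "compose (aff m) g (affine_push m \<alpha>) \<in> aff m \<rightarrow>\<^sub>E points X"
    using g affine_push_aff[OF \<alpha>] by (auto simp: smooth_maps_def compose_def)
  moreover have "compose U (compose (aff m) g (affine_push m \<alpha>)) p \<in> plots X k U"
    if p: "p \<in> plots (affine_simplex m) k U" for k U p
  proof -
    have p': "open_eucl k U" "\<And>u. u \<in> U \<Longrightarrow> p u \<in> aff m" "\<And>j. j < Suc m \<Longrightarrow> smooth_fun k U (\<lambda>u. p u j)"
      using p by (auto simp: affine_plots_iff)
    have "compose U (affine_push m \<alpha>) p \<in> plots (affine_simplex n) k U"
      unfolding affine_plots_iff
    proof (intro conjI allI impI p'(1))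
      show "compose U (affine_push m \<alpha>) p \<in> U \<rightarrow>\<^sub>E aff n"
        using affine_push_aff[OF \<alpha> p'(2)] by (auto simp: compose_def)
      show "smooth_fun k U (\<lambda>u. compose U (affine_push m \<alpha>) p u j)" for j
      proof (rule smooth_fun_cong)
        show "smooth_fun k U (\<lambda>u. \<Sum>i\<in>{i. i \<le> m \<and> \<alpha> i = j}. p u i)"
          by (rule smooth_fun_sum[OF p'(1)]) (use p'(3) in auto)
      qed (simp add: compose_def affine_push_def)
    qed
    from smooth_mapsD[OF g this] have "compose U g (compose U (affine_push m \<alpha>) p) \<in> plots X k U" .
    moreover have "compose U g (compose U (affine_push m \<alpha>) p) = compose U (compose (aff m) g (affine_push m \<alpha>)) p"
      using p'(2) by (auto simp: compose_def fun_eq_iff)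
    ultimately show ?thesis by simp
  qed
  ultimately show ?thesis unfolding smooth_maps_def by blast
qed

theorem simplicial_set_smooth_singular: "simplicial_set (smooth_singular X)"
proof
  fix \<alpha> m n g
  assume "\<alpha> \<in> simplex_hom m n" "g \<in> cells (smooth_singular X) n"
  then show "act (smooth_singular X) m n \<alpha> g \<in> cells (smooth_singular X) m"
    unfolding smooth_singular_cells smooth_singular_act
    using smooth_maps_affine_push simplex_hom_range by blast
next
  fix g n assume g: "g \<in> cells (smooth_singular X) n"
  have "affine_push n (\<lambda>i\<in>{..n}. i) x = x" if "x \<in> aff n" for x
    by (rule affine_push_retraction[where A = "{..n}"]) (use that in \<open>auto simp: aff_iff\<close>)
  moreover have "g \<in> extensional (aff n)"
    using g unfolding smooth_singular_cells smooth_maps_def by (auto simp: PiE_def)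
  ultimately show "act (smooth_singular X) n n (\<lambda>i\<in>{..n}. i) g = g"
    unfolding smooth_singular_act compose_def by (auto simp: extensional_def intro!: ext)
next
  fix \<alpha> l m \<beta> n g
  assume "\<alpha> \<in> simplex_hom l m" "\<beta> \<in> simplex_hom m n" "g \<in> cells (smooth_singular X) n"
  then have \<alpha>: "\<alpha> \<in> {..l} \<rightarrow> {..m}" by (simp add: simplex_hom_range)
  have push: "affine_push l (compose {..l} \<beta> \<alpha>) = (\<lambda>x. affine_push m \<beta> (affine_push l \<alpha> x))"
    by (rule ext) (rule affine_push_compose[OF \<alpha>])
  show "act (smooth_singular X) l n (compose {..l} \<beta> \<alpha>) g =
      act (smooth_singular X) l m \<alpha> (act (smooth_singular X) m n \<beta> g)"
    unfolding smooth_singular_act push using affine_push_aff[OF \<alpha>] by (auto simp: compose_def)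
qed

text \<open>
  Send \<open>i\<close> to the largest element of \<open>A\<close> not exceeding \<open>i\<close>, or to the smallest element of \<open>A\<close> if
  there is none.
\<close>

lemma monotone_retraction:
  assumes A: "A \<subseteq> {..n}" "A \<noteq> {}"
  obtains \<theta> where "\<theta> \<in> simplex_hom n n" "\<And>i. i \<le> n \<Longrightarrow> \<theta> i \<in> A" "\<And>i. i \<in> A \<Longrightarrow> \<theta> i = i"
proof -
  have fin: "finite A" using A(1) finite_subset by blast
  define low where "low i = {a \<in> A. a \<le> i}" for i
  have finlow: "finite (low i)" for i unfolding low_def using fin by simp
  define \<theta> where "\<theta> = (\<lambda>i\<in>{..n}. if low i = {} then Min A else Max (low i))"
  have in_A: "\<theta> i \<in> A" if "i \<le> n" for i
    using that Min_in[OF fin A(2)] Max_in[OF finlow, of i] by (auto simp: \<theta>_def low_def)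
  have fixed: "\<theta> i = i" if "i \<in> A" for i
  proof -
    have "i \<in> low i" using that by (simp add: low_def)
    moreover have "Max (low i) = i"
      by (rule Max_eqI[OF finlow]) (use that in \<open>auto simp: low_def\<close>)
    ultimately show ?thesis using that A(1) by (auto simp: \<theta>_def)
  qed
  have "\<theta> i \<le> \<theta> j" if "i \<le> j" "j \<le> n" for i j
  proof (cases "low i = {}")
    case True
    then show ?thesis
      using that in_A[of j] fin by (auto simp: \<theta>_def[of] intro!: Min_le)
  next
    case False
    have sub: "low i \<subseteq> low j" using that(1) by (auto simp: low_def)
    then have "low j \<noteq> {}" using False by blast
    then show ?thesis
      using False that Max_mono[OF sub False finlow] by (simp add: \<theta>_def)
  qed
  then have "\<theta> \<in> simplex_hom n n"
    using in_A A(1) unfolding simplex_hom_def by (auto simp: \<theta>_def intro!: mono_onI)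
  with in_A fixed that show thesis by blast
qed

lemma compose_retraction:
  assumes "\<theta> \<in> simplex_hom m n" "\<And>i. i \<le> m \<Longrightarrow> \<theta> i \<in> A" "\<And>a. a \<in> A \<Longrightarrow> e a = a"
  shows "compose {..m} e \<theta> = \<theta>"
  using assms by (auto simp: compose_def fun_eq_iff simplex_hom_def PiE_iff extensional_def)

section \<open>Horn filling\<close>

context smooth_manifold
begin

lemma horn_filler:
  assumes k: "k \<le> n" and n: "n \<ge> 1"
    and \<sigma>: "simplicial_map (horn n k) (smooth_singular (manifold_diffeology d M \<A>)) \<sigma>"
  obtains F where "F \<in> smooth_maps (affine_simplex n) (manifold_diffeology d M \<A>)"
    "\<And>m \<theta>. \<theta> \<in> cells (horn n k) m \<Longrightarrow> compose (aff m) F (affine_push m \<theta>) = \<sigma> m \<theta>"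
proof -
  define X where "X = manifold_diffeology d M \<A>"
  define I where "I = {..n} - {k}"
  \<comment> \<open>\<open>e i\<close> is an idempotent that misses exactly the vertex \<open>i\<close>.\<close>
  have "\<exists>e. \<forall>i. i \<in> I \<longrightarrow> e i \<in> simplex_hom n n \<and> (\<forall>j\<le>n. e i j \<in> {..n} - {i}) \<and>
      (\<forall>j\<in>{..n} - {i}. e i j = j)"
  proof (intro choice allI)
    fix i
    show "\<exists>e. i \<in> I \<longrightarrow> e \<in> simplex_hom n n \<and> (\<forall>j\<le>n. e j \<in> {..n} - {i}) \<and> (\<forall>j\<in>{..n} - {i}. e j = j)"
    proof (cases "i \<in> I")
      case True
      then have "{..n} - {i} \<noteq> {}" using k unfolding I_def by blast
      then show ?thesis using monotone_retraction[of "{..n} - {i}" n] by (metis Diff_subset)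
    qed simp
  qed
  then obtain e where e: "\<And>i. i \<in> I \<Longrightarrow> e i \<in> simplex_hom n n"
    "\<And>i j. i \<in> I \<Longrightarrow> j \<le> n \<Longrightarrow> e i j \<in> {..n} - {i}"
    "\<And>i j. i \<in> I \<Longrightarrow> j \<in> {..n} - {i} \<Longrightarrow> e i j = j"
    by blast
  have cell: "\<theta> \<in> cells (horn n k) m" if "\<theta> \<in> simplex_hom m n" "i \<in> I" "\<And>j. j \<le> m \<Longrightarrow> \<theta> j \<noteq> i" for \<theta> m i
    using that unfolding horn_def I_def by auto
  have e_cell: "e i \<in> cells (horn n k) n" if "i \<in> I" for i
    using cell[OF e(1)[OF that] that] e(2)[OF that] by blast
  have \<sigma>_cell: "\<sigma> m \<theta> \<in> smooth_maps (affine_simplex m) X" if "\<theta> \<in> cells (horn n k) m" for m \<theta>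
    using \<sigma> that unfolding simplicial_map_def smooth_singular_cells X_def by blast
  \<comment> \<open>A simplex \<open>\<theta>\<close> of the horn that misses \<open>i\<close> is obtained from \<open>e i\<close> by the operator \<open>\<theta>\<close> itself.\<close>
  have \<sigma>_face: "\<sigma> m \<theta> = compose (aff m) (\<sigma> n (e i)) (affine_push m \<theta>)"
    if \<theta>: "\<theta> \<in> simplex_hom m n" and i: "i \<in> I" and miss: "\<And>j. j \<le> m \<Longrightarrow> \<theta> j \<noteq> i" for \<theta> m i
  proof -
    have "\<theta> j \<in> {..n} - {i}" if "j \<le> m" for j
      using simplex_hom_range[OF \<theta>] miss[OF that] that by auto
    then have "compose {..m} (e i) \<theta> = \<theta>"
      by (rule compose_retraction[OF \<theta>, of "{..n} - {i}"]) (simp_all add: e(3)[OF i])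
    then have "act (horn n k) m n \<theta> (e i) = \<theta>"
      by (simp add: horn_def std_simplex_def)
    moreover have "\<sigma> m (act (horn n k) m n \<theta> (e i)) = act (smooth_singular X) m n \<theta> (\<sigma> n (e i))"
      using \<sigma> \<theta> e_cell[OF i] unfolding simplicial_map_def X_def by blast
    ultimately show ?thesis by (simp add: smooth_singular_act)
  qed
  \<comment> \<open>\<open>\<nu>\<close> identifies the affine simplex with the space of coordinates \<open>x\<^sub>i\<close>, \<open>i \<noteq> k\<close>. Instead of
    discarding the coordinate \<open>x\<^sub>k\<close>, it ignores it.\<close>
  define \<nu> where "\<nu> x = x(k := 1 - (\<Sum>i\<in>I. x i))" for x :: "nat \<Rightarrow> real"
  have split: "{..n} = insert k I" "k \<notin> I" "finite I" using k unfolding I_def by auto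
  have \<nu>_aff: "\<nu> x \<in> aff n" if "x \<in> eucl (Suc n)" for x
  proof -
    have "(\<Sum>i\<in>I. \<nu> x i) = (\<Sum>i\<in>I. x i)" using split(2) by (intro sum.cong) (auto simp: \<nu>_def)
    then have "(\<Sum>i\<le>n. \<nu> x i) = 1" using split by (simp add: \<nu>_def)
    then show ?thesis using that k by (auto simp: aff_iff \<nu>_def)
  qed
  have \<nu>_id: "\<nu> x = x" if "x \<in> aff n" for x
    using that split by (auto simp: \<nu>_def aff_iff fun_eq_iff)
  have \<nu>_plot: "restrict \<nu> (eucl (Suc n)) \<in> plots (affine_simplex n) (Suc n) (eucl (Suc n))"
    unfolding affine_plots_iff
  proof (intro conjI allI impI open_eucl_eucl)
    show "restrict \<nu> (eucl (Suc n)) \<in> eucl (Suc n) \<rightarrow>\<^sub>E aff n" using \<nu>_aff by auto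
    fix j
    have "smooth_fun (Suc n) (eucl (Suc n)) (\<lambda>x. \<nu> x j)"
      unfolding \<nu>_def
      by (cases "j = k") (auto intro!: smooth_fun_diff smooth_fun_sum smooth_fun_coord smooth_fun_const)
    then show "smooth_fun (Suc n) (eucl (Suc n)) (\<lambda>x. restrict \<nu> (eucl (Suc n)) x j)"
      by (rule smooth_fun_cong) simp
  qed
  define f where "f i x = \<sigma> n (e i) (\<nu> x)" for i x
  interpret hyperplane_data d M \<A> "Suc n" I f
  proof
    show "I \<subseteq> {..<Suc n}" unfolding I_def by auto
  next
    fix i assume i: "i \<in> I"
    have "compose (eucl (Suc n)) (\<sigma> n (e i)) (restrict \<nu> (eucl (Suc n))) \<in> plots X (Suc n) (eucl (Suc n))"
      by (rule smooth_mapsD[OF \<sigma>_cell[OF e_cell[OF i]] \<nu>_plot])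
    then have "smooth_into (Suc n) (eucl (Suc n)) (compose (eucl (Suc n)) (\<sigma> n (e i)) (restrict \<nu> (eucl (Suc n))))"
      unfolding X_def plots_iff by blast
    then show "smooth_into (Suc n) (eucl (Suc n)) (f i)"
      by (rule smooth_into_cong) (simp add: compose_def f_def)
  next
    fix i j and x :: "nat \<Rightarrow> real"
    assume i: "i \<in> I" and j: "j \<in> I" and x: "x \<in> eucl (Suc n)" "x i = 0" "x j = 0"
    \<comment> \<open>Here \<open>\<nu> x\<close> lies on the face that misses \<open>i\<close> and \<open>j\<close>, which is fixed by \<open>\<theta>\<close>. As \<open>i, j \<noteq> k\<close>, that
      face has the vertex \<open>k\<close>.\<close>
    have "k \<in> {..n} - {i, j}" using k i j unfolding I_def by blast
    then obtain \<theta> where \<theta>: "\<theta> \<in> simplex_hom n n" "\<And>l. l \<le> n \<Longrightarrow> \<theta> l \<in> {..n} - {i, j}"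
      "\<And>l. l \<in> {..n} - {i, j} \<Longrightarrow> \<theta> l = l"
      using monotone_retraction[of "{..n} - {i, j}" n] by (metis Diff_subset empty_iff)
    have aff: "\<nu> x \<in> aff n" by (rule \<nu>_aff[OF x(1)])
    have "affine_push n \<theta> (\<nu> x) = \<nu> x"
    proof (rule affine_push_retraction[OF _ \<theta>(2,3)])
      fix l assume "l \<notin> {..n} - {i, j}"
      then consider "l > n" | "l = i" | "l = j" by force
      then show "\<nu> x l = 0"
        using i j x aff by cases (auto simp: \<nu>_def I_def aff_iff)
    qed auto
    moreover have "\<sigma> n \<theta> = compose (aff n) (\<sigma> n (e i)) (affine_push n \<theta>)"
      by (rule \<sigma>_face[OF \<theta>(1) i]) (use \<theta>(2) in blast)
    moreover have "\<sigma> n \<theta> = compose (aff n) (\<sigma> n (e j)) (affine_push n \<theta>)"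
      by (rule \<sigma>_face[OF \<theta>(1) j]) (use \<theta>(2) in blast)
    ultimately have "\<sigma> n (e i) (\<nu> x) = \<sigma> n \<theta> (\<nu> x)" "\<sigma> n (e j) (\<nu> x) = \<sigma> n \<theta> (\<nu> x)"
      using aff by (metis compose_eq)+
    then show "f i x = f j x" by (simp add: f_def)
  qed
  have "I \<noteq> {}"
  proof
    assume "I = {}"
    then have "{..n} = {k}" using split by simp
    then have "card {..n} = 1" by simp
    then show False using n by simp
  qed
  then obtain F where F: "smooth_into (Suc n) (eucl (Suc n)) F"
    "\<And>i x. i \<in> I \<Longrightarrow> x \<in> eucl (Suc n) \<Longrightarrow> x i = 0 \<Longrightarrow> F x = f i x"
    by (rule global_extension) (rule that; assumption)
  have eucl: "x \<in> eucl (Suc n)" if "x \<in> aff n" for x using that unfolding aff_iff by blast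
  show thesis
  proof (rule that[unfolded X_def[symmetric]])
    show "restrict F (aff n) \<in> smooth_maps (affine_simplex n) X"
      unfolding smooth_maps_def
    proof (intro CollectI conjI allI ballI)
      show "restrict F (aff n) \<in> aff n \<rightarrow>\<^sub>E points X"
        using smooth_into_points[OF F(1) eucl] by (auto simp: X_def manifold_diffeology_def)
      fix m U p assume "p \<in> plots (affine_simplex n) m U"
      then have p: "open_eucl m U" "\<And>u. u \<in> U \<Longrightarrow> p u \<in> aff n" "\<And>j. j < Suc n \<Longrightarrow> smooth_fun m U (\<lambda>u. p u j)"
        by (auto simp: affine_plots_iff)
      have "smooth_into m U (\<lambda>u. F (p u))"
        by (rule smooth_into_compose[OF F(1) p(1) _ p(3)]) (use p(2) eucl in blast)
      then have "smooth_into m U (compose U (restrict F (aff n)) p)"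
        by (rule smooth_into_cong) (simp add: compose_def p(2))
      then show "compose U (restrict F (aff n)) p \<in> plots X m U"
        unfolding X_def plots_iff by (simp add: compose_def)
    qed
  next
    fix m \<theta> assume "\<theta> \<in> cells (horn n k) m"
    then obtain i where \<theta>: "\<theta> \<in> simplex_hom m n" and i: "i \<in> I" and miss: "\<And>j. j \<le> m \<Longrightarrow> \<theta> j \<noteq> i"
      unfolding horn_def I_def by auto
    have "F (affine_push m \<theta> x) = \<sigma> n (e i) (affine_push m \<theta> x)" if "x \<in> aff m" for x
    proof -
      have y: "affine_push m \<theta> x \<in> aff n"
        by (rule affine_push_aff[OF simplex_hom_range[OF \<theta>] that])
      have "{j. j \<le> m \<and> \<theta> j = i} = {}" using miss by blast
      then have "affine_push m \<theta> x i = 0" unfolding affine_push_def by (simp only: sum.empty)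
      then show ?thesis using F(2)[OF i eucl[OF y]] \<nu>_id[OF y] by (simp add: f_def)
    qed
    moreover have "\<sigma> m \<theta> = compose (aff m) (\<sigma> n (e i)) (affine_push m \<theta>)"
      by (rule \<sigma>_face[OF \<theta> i]) (rule miss)
    ultimately show "compose (aff m) (restrict F (aff n)) (affine_push m \<theta>) = \<sigma> m \<theta>"
      using affine_push_aff[OF simplex_hom_range[OF \<theta>]] by (auto simp: compose_def fun_eq_iff)
  qed
qed

theorem kan_complex_smooth_singular: "kan_complex (smooth_singular (manifold_diffeology d M \<A>))"
  unfolding kan_complex_def
proof (intro conjI allI impI simplicial_set_smooth_singular)
  let ?S = "smooth_singular (manifold_diffeology d M \<A>)"
  interpret S: simplicial_set ?S by (rule simplicial_set_smooth_singular)
  fix n k \<sigma> assume "1 \<le> n" "k \<le> n" "simplicial_map (horn n k) ?S \<sigma>"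
  then obtain F where F: "F \<in> cells ?S n"
    "\<And>m \<theta>. \<theta> \<in> cells (horn n k) m \<Longrightarrow> act ?S m n \<theta> F = \<sigma> m \<theta>"
    unfolding smooth_singular_cells smooth_singular_act
    using horn_filler[of k n \<sigma>] by blast
  have "simplicial_map (std_simplex n) ?S (\<lambda>m \<theta>. act ?S m n \<theta> F)"
    unfolding simplicial_map_def std_simplex_def
    using S.act_cells[OF _ F(1)] S.act_compose[OF _ _ F(1)] by simp
  then show "\<exists>\<tau>. simplicial_map (std_simplex n) ?S \<tau> \<and> (\<forall>m. \<forall>\<theta>\<in>cells (horn n k) m. \<tau> m \<theta> = \<sigma> m \<theta>)"
    using F(2) by (intro exI[of _ "\<lambda>m \<theta>. act ?S m n \<theta> F"]) blast
qed

end

theorem corollary4p36: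
  fixes d :: nat
    and M :: "'a topology"
    and \<A> :: "('a set \<times> ('a \<Rightarrow> nat \<Rightarrow> real)) set"
  assumes "smooth_manifold d M \<A>"
  shows "fibrant (manifold_diffeology d M \<A>)"
  unfolding fibrant_def
  using smooth_manifold.manifold_diffeological_space[OF assms]
    smooth_manifold.kan_complex_smooth_singular[OF assms] by blast

end
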